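(* Let $s,t,p\ge 1$, $A,B\in GL(n)$ and $Q\in\mathcal{P}(n)$ with $\lambda_1(Q)\le 1$. Put $\tilde k=\lambda_n(Q)$, $q=\min\{t/s,p/s\}$ and $\tilde q=\max\{t/s,p/s\}$. If $$\|A\|^2+\|B\|^2<\frac{q^{\tilde q}\,\tilde k^{\tilde q+1}}{(q+1)^{\tilde q+1}},$$ then the equation $X^s+A^*X^{-t}A+B^*X^{-p}B=Q$ has a Hermitian positive definite solution in $\big[\big(\tfrac{q\tilde k}{q+1}\big)^{1/s}I,\;Q^{1/s}\big]$.
   Context: $GL(n)$: $n\times n$ complex nonsingular matrices; $\mathcal{P}(n)$: $n\times n$ Hermitian positive definite matrices. For Hermitian $M$, $\lambda_1(M)$ and $\lambda_n(M)$ are its largest and smallest eigenvalues. $\|\cdot\|$ is the spectral (operator) norm. For Hermitian $P,R$, $P\le R$ means $R-P$ is positive semidefinite, and $[P,R]=\{X \text{ Hermitian}: P\le X\le R\}$. Real powers of positive definite matrices are defined by functional calculus. *)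

theory Defs
  imports "Jordan_Normal_Form.Spectral_Radius" "Jordan_Normal_Form.Schur_Decomposition"
begin

definition GL :: "nat \<Rightarrow> complex mat set" where
  "GL n = {A. A \<in> carrier_mat n n \<and> invertible_mat A}"

definition hermitian :: "complex mat \<Rightarrow> bool" where
  "hermitian A \<longleftrightarrow> square_mat A \<and> mat_adjoint A = A"

text \<open>Quadratic form v* A v (real part; it is real for Hermitian A).\<close>
definition qform :: "complex mat \<Rightarrow> complex vec \<Rightarrow> real" where
  "qform A v = Re ((A *\<^sub>v v) \<bullet> conjugate v)"

definition pos_def :: "complex mat \<Rightarrow> bool" where
  "pos_def A \<longleftrightarrow> hermitian A \<and>
     (\<forall>v \<in> carrier_vec (dim_row A). v \<noteq> 0\<^sub>v (dim_row A) \<longrightarrow> qform A v > 0)"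

definition pos_semidef :: "complex mat \<Rightarrow> bool" where
  "pos_semidef A \<longleftrightarrow> hermitian A \<and>
     (\<forall>v \<in> carrier_vec (dim_row A). qform A v \<ge> 0)"

definition PD :: "nat \<Rightarrow> complex mat set" where
  "PD n = {A. A \<in> carrier_mat n n \<and> pos_def A}"

definition loewner_le :: "complex mat \<Rightarrow> complex mat \<Rightarrow> bool" where
  "loewner_le P R \<longleftrightarrow> dim_row P = dim_row R \<and> dim_col P = dim_col R \<and> pos_semidef (R - P)"

definition mat_interval :: "complex mat \<Rightarrow> complex mat \<Rightarrow> complex mat set" where
  "mat_interval P R = {X. hermitian X \<and> loewner_le P X \<and> loewner_le X R}"

text \<open>Largest and smallest eigenvalues of a Hermitian matrix (eigenvalues are real).\<close>
definition lambda_max :: "complex mat \<Rightarrow> real" where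
  "lambda_max A = Max (Re ` spectrum A)"

definition lambda_min :: "complex mat \<Rightarrow> real" where
  "lambda_min A = Min (Re ` spectrum A)"

definition vnorm :: "complex vec \<Rightarrow> real" where
  "vnorm v = sqrt (Re (v \<bullet> conjugate v))"

definition op_norm :: "complex mat \<Rightarrow> real" where
  "op_norm A = Sup {vnorm (A *\<^sub>v v) | v. v \<in> carrier_vec (dim_col A) \<and> vnorm v = 1}"

definition unitary :: "complex mat \<Rightarrow> bool" where
  "unitary U \<longleftrightarrow> square_mat U \<and> U * mat_adjoint U = 1\<^sub>m (dim_row U)
                   \<and> mat_adjoint U * U = 1\<^sub>m (dim_row U)"

definition real_diag :: "nat \<Rightarrow> (nat \<Rightarrow> real) \<Rightarrow> complex mat" where
  "real_diag n d = mat n n (\<lambda>(i,j). if i = j then complex_of_real (d i) else 0)"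

definition mat_powr :: "complex mat \<Rightarrow> real \<Rightarrow> complex mat" where
  "mat_powr P r = (SOME X. \<exists>U d. U \<in> carrier_mat (dim_row P) (dim_row P) \<and> unitary U \<and>
       (\<forall>i < dim_row P. d i > 0) \<and>
       P = U * real_diag (dim_row P) d * mat_adjoint U \<and>
       X = U * real_diag (dim_row P) (\<lambda>i. d i powr r) * mat_adjoint U)"

end

theory Submission
  imports Defs "HOL-Analysis.Analysis"
begin

text \<open>
  With $Y = X^s$, $a = t/s$ and $b = p/s$ the equation reads $Y = Q - A^* Y^{-a} A - B^* Y^{-b} B$.
  Put $m = q k/(q+1)$ and replace $x^{-a}$ and $x^{-b}$ by the bounded Lipschitz functions
  $\max(x,m)^{-a}$ and $\max(x,m)^{-b}$. The norm condition makes the modified right-hand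
  side map every Hermitian matrix into $[mI, Q]$, so Brouwer gives a fixed point $Y$ with
  $Y \ge mI$, where the truncation has no effect. Continuity of the functional calculus is the
  Frobenius-norm estimate $\|g(Y)-g(Z)\|_F \le L\,\|Y-Z\|_F$, seen by comparing the two matrices in the
  eigenbases of $Y$ and $Z$. The bound $X = Y^{1/s} \le Q^{1/s}$ is the Loewner--Heinz inequality.

  The dimension is a natural number rather than a type, so Brouwer's theorem is derived
  directly from Kuhn's combinatorial lemma for cubes in \<^typ>\<open>nat \<Rightarrow> real\<close>.
\<close>

text \<open>The threshold on the norms is a scalar computation. The point \<open>m\<close> maximizes
  \<open>x^q (k - x)\<close> on \<open>[0, k]\<close>; since \<open>k - m = k/(q+1)\<close>, the
  number \<open>m^q' (k - m)\<close>, with \<open>q'\<close> the larger of \<open>a\<close> and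
  \<open>b\<close>, is exactly the right-hand side of the norm condition. The bound 1 on the
  eigenvalues of \<open>Q\<close> yields \<open>m\<close> \<le> 1, which lets the single power
  \<open>m^(-q')\<close> dominate both \<open>m^(-a)\<close> and \<open>m^(-b)\<close>. A fixed
  point theorem without order is used because \<open>a\<close> or \<open>b\<close> may exceed 1. The
  function \<open>x^(-a)\<close> is then not operator antitone, and monotone iteration from an end
  of the interval breaks down. Truncation makes the map total and bounded on all Hermitian matrices,
  so Brouwer can work on a box of matrix coordinates that has nothing to do with the order interval.
  As \<open>mat_powr\<close> is a choice among diagonalizations, independence of that choice has to
  precede every computation with powers.\<close>

hide_const (open) Finite_Cartesian_Product.mat Finite_Cartesian_Product.vec Finite_Cartesian_Product.row
  Finite_Cartesian_Product.column Determinants.det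
hide_type (open) Finite_Cartesian_Product.vec
no_notation Finite_Cartesian_Product.vec_nth (infixl "$" 90)
no_notation inner (infix "\<bullet>" 70)

section \<open>Adjoints and the spectral theorem\<close>

text \<open>In the library's carrier rules for products the inner dimension does not occur in the conclusion,
  so the simplifier cannot discharge them; the square versions can serve as rewrite rules.\<close>

lemma square_mult_carrier [simp]:
  "M \<in> carrier_mat n n \<Longrightarrow> N \<in> carrier_mat n n \<Longrightarrow> M * N \<in> carrier_mat n n"
  by (rule mult_carrier_mat)

lemma square_mult_vec_carrier [simp]:
  "M \<in> carrier_mat n n \<Longrightarrow> v \<in> carrier_vec n \<Longrightarrow> M *\<^sub>v v \<in> carrier_vec n"
  by (rule mult_mat_vec_carrier)

lemma square_minus_carrier [simp]:
  "M \<in> carrier_mat n n \<Longrightarrow> N \<in> carrier_mat n n \<Longrightarrow> M - N \<in> carrier_mat n n"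
  by (rule minus_carrier_mat)

lemma square_mult_assoc:
  "L \<in> carrier_mat n n \<Longrightarrow> M \<in> carrier_mat n n \<Longrightarrow> N \<in> carrier_mat n n
    \<Longrightarrow> L * M * N = L * (M * N)"
  by (rule assoc_mult_mat)

lemma mat_adjoint_carrier [simp]:
  "M \<in> carrier_mat r c \<Longrightarrow> mat_adjoint M \<in> carrier_mat c r"
  by (auto simp: mat_adjoint_def mat_of_rows_def)

lemma dim_mat_adjoint [simp]:
  "dim_row (mat_adjoint M) = dim_col M" "dim_col (mat_adjoint M) = dim_row M"
  by (auto simp: mat_adjoint_def mat_of_rows_def)

lemma index_mat_adjoint [simp]:
  fixes M :: "complex mat"
  assumes "i < dim_col M" "j < dim_row M"
  shows "mat_adjoint M $$ (i, j) = cnj (M $$ (j, i))"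
  using assms by (auto simp: mat_adjoint_def mat_of_rows_def)

lemma mat_adjoint_adjoint [simp]: "mat_adjoint (mat_adjoint M) = (M :: complex mat)"
  by (rule eq_matI) auto

lemma mat_adjoint_mult:
  fixes M N :: "complex mat"
  assumes "M \<in> carrier_mat r m" "N \<in> carrier_mat m c"
  shows "mat_adjoint (M * N) = mat_adjoint N * mat_adjoint M"
  using assms by (intro eq_matI) (auto simp: scalar_prod_def mult.commute)

lemma mat_adjoint_minus:
  fixes M N :: "complex mat"
  assumes "M \<in> carrier_mat r c" "N \<in> carrier_mat r c"
  shows "mat_adjoint (M - N) = mat_adjoint M - mat_adjoint N"
  using assms by (intro eq_matI) auto

lemma mat_adjoint_one [simp]: "mat_adjoint (1\<^sub>m n :: complex mat) = 1\<^sub>m n"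
  by (intro eq_matI) auto

section \<open>Inner product, Euclidean norm and unitary matrices\<close>

lemma cscalar_prod_mult_mat_vec:
  fixes M :: "complex mat"
  assumes M: "M \<in> carrier_mat r c" and v: "v \<in> carrier_vec c" and w: "w \<in> carrier_vec r"
  shows "(M *\<^sub>v v) \<bullet>c w = v \<bullet>c (mat_adjoint M *\<^sub>v w)"
proof -
  have "(M *\<^sub>v v) \<bullet>c w = (\<Sum>i<r. \<Sum>j<c. M $$ (i, j) * v $ j * cnj (w $ i))"
    using assms by (auto simp: scalar_prod_def sum_distrib_right atLeast0LessThan intro!: sum.cong)
  also have "\<dots> = (\<Sum>j<c. \<Sum>i<r. M $$ (i, j) * v $ j * cnj (w $ i))"
    by (rule sum.swap)
  also have "\<dots> = v \<bullet>c (mat_adjoint M *\<^sub>v w)"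
    using assms by (auto simp: scalar_prod_def sum_distrib_left atLeast0LessThan ac_simps intro!: sum.cong)
  finally show ?thesis .
qed

lemma vnorm_sq: "(vnorm v)\<^sup>2 = (\<Sum>i<dim_vec v. (cmod (v $ i))\<^sup>2)"
  and vnorm_nonneg [simp]: "0 \<le> vnorm v"
proof -
  have *: "Re (v \<bullet>c v) = (\<Sum>i<dim_vec v. (cmod (v $ i))\<^sup>2)"
    by (auto simp: scalar_prod_def atLeast0LessThan cmod_power2 power2_eq_square[symmetric] intro!: sum.cong)
  then have "Re (v \<bullet>c v) \<ge> 0"
    by (simp add: sum_nonneg)
  then show "(vnorm v)\<^sup>2 = (\<Sum>i<dim_vec v. (cmod (v $ i))\<^sup>2)" "0 \<le> vnorm v"
    by (auto simp: vnorm_def *)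
qed

lemma Re_cscalar_prod_self: "Re (v \<bullet>c v) = (vnorm v)\<^sup>2"
  unfolding vnorm_sq
  by (auto simp: scalar_prod_def atLeast0LessThan cmod_power2 power2_eq_square[symmetric] intro!: sum.cong)

lemma vnorm_eq_0_iff: "v \<in> carrier_vec n \<Longrightarrow> vnorm v = 0 \<longleftrightarrow> v = 0\<^sub>v n"
proof
  assume v: "v \<in> carrier_vec n" and "vnorm v = 0"
  then have "(\<Sum>i<n. (cmod (v $ i))\<^sup>2) = 0"
    using vnorm_sq[of v] by simp
  then have "\<forall>i<n. v $ i = 0"
    by (subst (asm) sum_nonneg_eq_0_iff) auto
  with v show "v = 0\<^sub>v n" by (intro eq_vecI) auto
next
  assume "v = 0\<^sub>v n"
  then have "(vnorm v)\<^sup>2 = 0" by (simp only: vnorm_sq) simp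
  then show "vnorm v = 0" by simp
qed

lemma vnorm_smult: "vnorm (c \<cdot>\<^sub>v v) = cmod c * vnorm v"
proof -
  have "(vnorm (c \<cdot>\<^sub>v v))\<^sup>2 = (cmod c * vnorm v)\<^sup>2"
    unfolding power_mult_distrib vnorm_sq by (simp add: norm_mult power_mult_distrib sum_distrib_left)
  then show ?thesis by simp
qed

lemma unitaryD:
  assumes "unitary U" "U \<in> carrier_mat n n"
  shows "U * mat_adjoint U = 1\<^sub>m n" "mat_adjoint U * U = 1\<^sub>m n"
  using assms by (auto simp: unitary_def)

lemma unitaryI:
  assumes U: "U \<in> carrier_mat n n" and "mat_adjoint U * U = 1\<^sub>m n"
  shows "unitary U"
  using assms mat_mult_left_right_inverse[of "mat_adjoint U" n U] by (auto simp: unitary_def)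

lemma unitary_adjoint: "unitary U \<Longrightarrow> unitary (mat_adjoint U)"
  by (auto simp: unitary_def)

lemma unitary_mult:
  assumes U: "U \<in> carrier_mat n n" "unitary U" and V: "V \<in> carrier_mat n n" "unitary V"
  shows "unitary (U * V)"
proof (rule unitaryI)
  have "mat_adjoint (U * V) * (U * V) = mat_adjoint V * (mat_adjoint U * U) * V"
    using U(1) V(1) by (simp add: mat_adjoint_mult[of _ n n _ n] square_mult_assoc[of _ n])
  also have "\<dots> = 1\<^sub>m n"
    using U V by (simp add: unitaryD[of U n] unitaryD[of V n])
  finally show "mat_adjoint (U * V) * (U * V) = 1\<^sub>m n" .
qed (use U V in auto)

lemma vnorm_unitary:
  assumes U: "U \<in> carrier_mat n n" "unitary U" and v: "v \<in> carrier_vec n"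
  shows "vnorm (U *\<^sub>v v) = vnorm v"
proof -
  have "(U *\<^sub>v v) \<bullet>c (U *\<^sub>v v) = v \<bullet>c (mat_adjoint U *\<^sub>v (U *\<^sub>v v))"
    using assms by (intro cscalar_prod_mult_mat_vec[of _ n n]) auto
  also have "mat_adjoint U *\<^sub>v (U *\<^sub>v v) = v"
    using assms by (simp add: assoc_mult_mat_vec[of _ n n _ n, symmetric] unitaryD[of U n])
  finally show ?thesis by (simp add: vnorm_def)
qed

text \<open>Basis completion followed by Gram-Schmidt keeps \<open>v\<close> as the first vector.
  The resulting vectors are orthogonal but not normalized, so the columns of \<open>U\<close> are
  divided by their lengths; \<open>c\<close> is the reciprocal of \<open>vnorm v\<close>.\<close>

lemma unitary_first_col_exists:
  fixes v :: "complex vec"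
  assumes v: "v \<in> carrier_vec n" "v \<noteq> 0\<^sub>v n"
  obtains U c where "U \<in> carrier_mat n n" "unitary U" "col U 0 = c \<cdot>\<^sub>v v" "c \<noteq> 0"
proof -
  have n: "n \<noteq> 0" using v by auto
  interpret cof_vec_space n "TYPE(complex)" .
  define b where "b = basis_completion v"
  define ws where "ws = gram_schmidt n b"
  note bc = basis_completion[OF v, folded b_def]
  obtain vs where bv: "b = v # vs" using bc(6,7) n by (cases b) auto
  have ws: "set ws \<subseteq> carrier_vec n" "corthogonal ws" "length ws = n"
    using gram_schmidt_result[OF bc(2) bc(4) bc(5) refl, folded ws_def] bc(6) by auto
  have hd: "ws ! 0 = v" using gram_schmidt_hd[OF v(1), of vs, folded bv ws_def] ws(3) n
    by (cases ws) auto
  have wc: "ws ! i \<in> carrier_vec n" if "i < n" for i using ws that by auto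
  have w0: "ws ! i \<noteq> 0\<^sub>v n" if "i < n" for i
  proof
    assume "ws ! i = 0\<^sub>v n"
    then have "ws ! i \<bullet>c ws ! i = 0" by simp
    then show False using corthogonalD[OF ws(2), of i i] that ws(3) by auto
  qed
  have nz: "vnorm (ws ! i) \<noteq> 0" if "i < n" for i
    using vnorm_eq_0_iff[OF wc[OF that]] w0[OF that] by auto
  define U where "U = mat n n (\<lambda>(i, j). ws ! j $ i / complex_of_real (vnorm (ws ! j)))"
  have U: "U \<in> carrier_mat n n" by (simp add: U_def)
  have cs: "ws ! i \<bullet>c ws ! i = complex_of_real ((vnorm (ws ! i))\<^sup>2)" for i
    unfolding vnorm_sq of_real_sum
    by (auto simp: scalar_prod_def atLeast0LessThan complex_norm_square simp del: of_real_power intro!: sum.cong)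
  have "mat_adjoint U * U = 1\<^sub>m n"
  proof (rule eq_matI)
    fix i j assume "i < dim_row (1\<^sub>m n :: complex mat)" "j < dim_col (1\<^sub>m n :: complex mat)"
    then have ij: "i < n" "j < n" by auto
    have "(mat_adjoint U * U) $$ (i, j) = (\<Sum>k<n. cnj (U $$ (k, i)) * U $$ (k, j))"
      using U ij by (auto simp: scalar_prod_def atLeast0LessThan)
    also have "\<dots> = (ws ! j \<bullet>c ws ! i) / (vnorm (ws ! i) * vnorm (ws ! j))"
      using ij carrier_vecD[OF wc] by (auto simp: U_def scalar_prod_def atLeast0LessThan sum_divide_distrib mult.commute intro!: sum.cong)
    also have "\<dots> = 1\<^sub>m n $$ (i, j)"
      using corthogonalD[OF ws(2), of j i] ij ws(3) nz[OF ij(1)] by (auto simp: cs power2_eq_square)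
    finally show "(mat_adjoint U * U) $$ (i, j) = 1\<^sub>m n $$ (i, j)" .
  qed (use U in auto)
  then have un: "unitary U" using U by (intro unitaryI)
  have "col U 0 = (1 / complex_of_real (vnorm v)) \<cdot>\<^sub>v v"
    using v n hd by (intro eq_vecI) (auto simp: U_def)
  then show ?thesis using that[OF U un] nz[of 0] n hd by auto
qed

lemma real_diag_carrier [simp]: "real_diag n d \<in> carrier_mat n n"
  by (simp add: real_diag_def)

lemma hermitianD: "hermitian M \<Longrightarrow> mat_adjoint M = M"
  by (simp add: hermitian_def)

lemma hermitian_adjoint_mult:
  assumes "M \<in> carrier_mat n n" "N \<in> carrier_mat n n" "hermitian N"
  shows "hermitian (mat_adjoint M * N * M)"
  using assms
  by (auto simp: hermitian_def mat_adjoint_mult[of _ n n _ n] square_mult_assoc[of _ n])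

text \<open>Deflation by induction on the dimension. With a unit eigenvector as first column of
  \<open>U\<close>, the conjugated matrix has a multiple of a unit vector as its first column.
  Self-adjointness then clears the first row too, and the remaining block is Hermitian of size
  \<open>n\<close>.\<close>

lemma hermitian_spectral:
  assumes "M \<in> carrier_mat n n" "hermitian M"
  shows "\<exists>U d. U \<in> carrier_mat n n \<and> unitary U \<and> M = U * real_diag n d * mat_adjoint U"
  using assms
proof (induction n arbitrary: M)
  case 0
  then show ?case
    by (intro exI[of _ "1\<^sub>m 0"] exI[of _ "\<lambda>_. 0"]) (auto simp: unitary_def)
next
  case (Suc n)
  note M = Suc.prems
  obtain e v where v: "v \<in> carrier_vec (Suc n)" "v \<noteq> 0\<^sub>v (Suc n)" "M *\<^sub>v v = e \<cdot>\<^sub>v v"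
    using spectrum_non_empty[OF M(1)] M(1) by (auto simp: spectrum_def eigenvalue_def eigenvector_def)
  obtain U c where U: "U \<in> carrier_mat (Suc n) (Suc n)" "unitary U" and c: "col U 0 = c \<cdot>\<^sub>v v"
    using unitary_first_col_exists[OF v(1,2)] by metis
  define M1 where "M1 = mat_adjoint U * M * U"
  have M1: "M1 \<in> carrier_mat (Suc n) (Suc n)" using M U by (simp add: M1_def)
  have hM1: "hermitian M1" unfolding M1_def using M U by (intro hermitian_adjoint_mult) auto
  have ev: "M *\<^sub>v col U 0 = e \<cdot>\<^sub>v col U 0"
    using M v by (simp add: c mult_mat_vec[of _ "Suc n" "Suc n"] smult_smult_assoc mult.commute)
  have "col M1 0 = col (mat_adjoint U * (M * U)) 0"
    using M U by (simp only: M1_def square_mult_assoc[of _ "Suc n"] mat_adjoint_carrier)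
  also have "\<dots> = mat_adjoint U *\<^sub>v col (M * U) 0"
    by (rule col_mult2[of _ "Suc n" "Suc n" _ "Suc n"]) (use M U in auto)
  also have "col (M * U) 0 = M *\<^sub>v col U 0"
    by (rule col_mult2[of _ "Suc n" "Suc n" _ "Suc n"]) (use M U in auto)
  also have "mat_adjoint U *\<^sub>v (M *\<^sub>v col U 0) = e \<cdot>\<^sub>v (mat_adjoint U *\<^sub>v col U 0)"
    unfolding ev using U by (intro mult_mat_vec[of _ "Suc n" "Suc n"] col_carrier_vec) auto
  also have "mat_adjoint U *\<^sub>v col U 0 = col (mat_adjoint U * U) 0"
    by (rule col_mult2[of _ "Suc n" "Suc n" _ "Suc n", symmetric]) (use U in auto)
  also have "\<dots> = col (1\<^sub>m (Suc n)) 0" using U by (simp add: unitaryD)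
  finally have c0: "col M1 0 = e \<cdot>\<^sub>v unit_vec (Suc n) 0" by simp
  have i0: "M1 $$ (i, 0) = (if i = 0 then e else 0)" if "i < Suc n" for i
    using arg_cong[OF c0, of "\<lambda>w. w $ i"] that M1 by auto
  have sym: "M1 $$ (i, j) = cnj (M1 $$ (j, i))" if "i < Suc n" "j < Suc n" for i j
    using arg_cong[OF hermitianD[OF hM1], of "\<lambda>w. w $$ (i, j)"] that M1 by auto
  have j0: "M1 $$ (0, j) = (if j = 0 then e else 0)" if "j < Suc n" for j
    using sym[OF _ that, of 0] i0[OF that] i0[of 0] by auto
  \<comment> \<open>A diagonal entry of a Hermitian matrix equals its own conjugate, so the
    eigenvalue is real.\<close>
  have e: "complex_of_real (Re e) = e"
    using sym[of 0 0] i0[of 0] by (auto simp: complex_eq_iff)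
  define M2 where "M2 = mat n n (\<lambda>(i, j). M1 $$ (Suc i, Suc j))"
  have M2: "M2 \<in> carrier_mat n n" by (simp add: M2_def)
  have "hermitian M2"
    unfolding hermitian_def by (auto simp: M2_def sym[symmetric] intro!: eq_matI)
  then obtain U2 d2 where U2: "U2 \<in> carrier_mat n n" "unitary U2"
      and M2eq: "M2 = U2 * real_diag n d2 * mat_adjoint U2"
    using Suc.IH[OF M2] by blast
  let ?blk = "\<lambda>X Y. four_block_mat X (0\<^sub>m 1 n) (0\<^sub>m n 1) Y :: complex mat"
  define U3 where "U3 = ?blk (1\<^sub>m 1) U2"
  define d where "d = case_nat (Re e) d2"
  have U3: "U3 \<in> carrier_mat (Suc n) (Suc n)" using U2 by (auto simp: U3_def)
  have blk_mult: "?blk X Y * ?blk X' Y' = ?blk (X * X') (Y * Y')"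
    if "X \<in> carrier_mat 1 1" "X' \<in> carrier_mat 1 1" "Y \<in> carrier_mat n n" "Y' \<in> carrier_mat n n"
    for X X' Y Y'
    using that by (subst mult_four_block_mat[of _ 1 1 _ n _ n _ _ 1 _ n]) auto
  have adjU3: "mat_adjoint U3 = ?blk (1\<^sub>m 1) (mat_adjoint U2)"
    using U2 by (intro eq_matI) (auto simp: U3_def)
  have one: "?blk (1\<^sub>m 1) (1\<^sub>m n) = 1\<^sub>m (Suc n)"
    by (intro eq_matI) auto
  have uU3: "unitary U3"
    using U2 by (intro unitaryI[OF U3], unfold adjU3, unfold U3_def)
      (simp add: blk_mult unitaryD[of U2 n] flip: one del: One_nat_def four_block_one_mat)
  have rd: "real_diag (Suc n) d = ?blk (real_diag 1 (\<lambda>_. Re e)) (real_diag n d2)"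
    by (intro eq_matI) (auto simp: real_diag_def d_def split: nat.splits)
  have "M1 = ?blk (real_diag 1 (\<lambda>_. Re e)) M2"
    using M1 by (intro eq_matI) (auto simp: M2_def real_diag_def i0 j0 e)
  also have "\<dots> = U3 * real_diag (Suc n) d * mat_adjoint U3"
    unfolding adjU3 unfolding U3_def rd using U2
    by (simp add: blk_mult M2eq left_mult_one_mat[of _ 1 1] right_mult_one_mat[of _ 1 1] del: One_nat_def)
  finally have M1eq: "M1 = U3 * real_diag (Suc n) d * mat_adjoint U3" .
  have "U * M1 * mat_adjoint U = (U * mat_adjoint U) * M * (U * mat_adjoint U)"
    using M U by (simp add: M1_def square_mult_assoc[of _ "Suc n"])
  also have "\<dots> = M" using M U by (simp add: unitaryD[of U "Suc n"])
  finally have "M = U * M1 * mat_adjoint U" by simp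
  also have "\<dots> = (U * U3) * real_diag (Suc n) d * mat_adjoint (U * U3)"
    using U U3 M1 by (simp add: M1eq mat_adjoint_mult[of _ "Suc n" "Suc n" _ "Suc n"] square_mult_assoc[of _ "Suc n"])
  finally show ?case
    using unitary_mult[OF U U3 uU3] U U3 by (intro exI[of _ "U * U3"] exI[of _ d]) auto
qed

section \<open>Functional calculus\<close>

text \<open>The eigenvalues are a function on the naturals of which \<open>real_diag\<close> reads
  the values below \<open>n\<close>. Their order is left open, so one matrix has many
  diagonalizations.\<close>

definition diagonalizes :: "nat \<Rightarrow> complex mat \<Rightarrow> (nat \<Rightarrow> real) \<Rightarrow> complex mat \<Rightarrow> bool" where
  "diagonalizes n U d M \<longleftrightarrow> U \<in> carrier_mat n n \<and> unitary U \<and> M = U * real_diag n d * mat_adjoint U"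

lemma diagonalizesD:
  assumes "diagonalizes n U d M"
  shows "U \<in> carrier_mat n n" "unitary U" "M = U * real_diag n d * mat_adjoint U" "M \<in> carrier_mat n n"
  using assms by (auto simp: diagonalizes_def)

lemma mat_adjoint_real_diag [simp]: "mat_adjoint (real_diag n d) = real_diag n d"
  by (intro eq_matI) (auto simp: real_diag_def)

lemma diagonalizes_hermitian:
  assumes "diagonalizes n U d M"
  shows "hermitian M"
proof -
  note D = diagonalizesD[OF assms]
  have "hermitian (mat_adjoint (mat_adjoint U) * real_diag n d * mat_adjoint U)"
    using D(1) by (intro hermitian_adjoint_mult[of _ n]) (auto simp: hermitian_def real_diag_def)
  then show ?thesis by (simp add: D(3))
qed

lemma dim_real_diag [simp]: "dim_row (real_diag n d) = n" "dim_col (real_diag n d) = n"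
  by (simp_all add: real_diag_def)

lemma real_diag_mult_index:
  assumes "M \<in> carrier_mat n n" "i < n" "j < n"
  shows "(real_diag n d * M) $$ (i, j) = complex_of_real (d i) * M $$ (i, j)"
    and "(M * real_diag n d) $$ (i, j) = complex_of_real (d j) * M $$ (i, j)"
  using assms by (auto simp: real_diag_def scalar_prod_def if_distrib[of "\<lambda>x. x * _"] if_distrib[of "\<lambda>x. _ * x"]
      sum.delta sum.delta' cong: if_cong)

lemma real_diag_mult_vec:
  assumes "v \<in> carrier_vec n" "i < n"
  shows "(real_diag n d *\<^sub>v v) $ i = complex_of_real (d i) * v $ i"
  using assms by (auto simp: real_diag_def scalar_prod_def if_distrib[of "\<lambda>x. x * _"] cong: if_cong)

lemma real_diag_mult: "real_diag n d * real_diag n e = real_diag n (\<lambda>i. d i * e i)"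
  by (rule eq_matI) (auto simp: real_diag_mult_index real_diag_def scalar_prod_def if_distrib[of "\<lambda>x. x * _"] cong: if_cong)

lemma vnorm_eq_sum_unitary:
  assumes "U \<in> carrier_mat n n" "unitary U" "v \<in> carrier_vec n"
  shows "(vnorm v)\<^sup>2 = (\<Sum>i<n. (cmod ((mat_adjoint U *\<^sub>v v) $ i))\<^sup>2)"
  using vnorm_unitary[of "mat_adjoint U" n v] vnorm_sq[of "mat_adjoint U *\<^sub>v v"] assms
  by (simp add: unitary_adjoint)

lemma qform_diagonalizes:
  assumes "diagonalizes n U d M" and v: "v \<in> carrier_vec n"
  shows "qform M v = (\<Sum>i<n. d i * (cmod ((mat_adjoint U *\<^sub>v v) $ i))\<^sup>2)"
proof -
  note D = diagonalizesD[OF assms(1)]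
  define w where "w = mat_adjoint U *\<^sub>v v"
  have w: "w \<in> carrier_vec n" using D v by (simp add: w_def)
  have "M *\<^sub>v v = U *\<^sub>v (real_diag n d *\<^sub>v w)"
    using D v by (simp add: w_def assoc_mult_mat_vec[of _ n n _ n])
  then have "(M *\<^sub>v v) \<bullet>c v = (real_diag n d *\<^sub>v w) \<bullet>c w"
    using D v w by (simp add: cscalar_prod_mult_mat_vec[of U n n] w_def)
  also have "\<dots> = (\<Sum>i<n. complex_of_real (d i * (cmod (w $ i))\<^sup>2))"
    using w by (auto simp: scalar_prod_def[of "real_diag n d *\<^sub>v w"] real_diag_mult_vec atLeast0LessThan complex_norm_square mult.assoc
        simp del: of_real_power index_mult_mat_vec intro!: sum.cong)
  finally show ?thesis by (simp add: qform_def w_def)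
qed

section \<open>The Frobenius norm and the comparison of two eigenbases\<close>

definition frob_sq :: "complex mat \<Rightarrow> real" where
  "frob_sq M = (\<Sum>j<dim_col M. \<Sum>i<dim_row M. (cmod (M $$ (i, j)))\<^sup>2)"

lemma frob_sq_cols: "frob_sq M = (\<Sum>j<dim_col M. (vnorm (col M j))\<^sup>2)"
  by (simp add: frob_sq_def vnorm_sq)

lemma frob_sq_adjoint: "frob_sq (mat_adjoint M) = frob_sq M"
  unfolding frob_sq_def by (subst sum.swap) simp

lemma frob_sq_unitary_left:
  assumes "U \<in> carrier_mat n n" "unitary U" "M \<in> carrier_mat n n"
  shows "frob_sq (U * M) = frob_sq M"
proof -
  have "vnorm (col (U * M) j) = vnorm (col M j)" if "j < n" for j
    unfolding col_mult2[OF assms(1,3) that] using assms that by (intro vnorm_unitary) auto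
  then show ?thesis using assms by (simp add: frob_sq_cols)
qed

lemma frob_sq_unitary_right:
  assumes "U \<in> carrier_mat n n" "unitary U" "M \<in> carrier_mat n n"
  shows "frob_sq (M * U) = frob_sq M"
proof -
  have "frob_sq (M * U) = frob_sq (mat_adjoint U * mat_adjoint M)"
    using assms by (simp add: mat_adjoint_mult[of _ n n _ n, symmetric] frob_sq_adjoint)
  then show ?thesis
    using assms by (simp add: frob_sq_unitary_left[of _ n] unitary_adjoint frob_sq_adjoint)
qed

lemma cmod_index_le_frob_sq:
  assumes "i < dim_row M" "j < dim_col M"
  shows "(cmod (M $$ (i, j)))\<^sup>2 \<le> frob_sq M"
proof -
  have "(cmod (M $$ (i, j)))\<^sup>2 \<le> (\<Sum>i<dim_row M. (cmod (M $$ (i, j)))\<^sup>2)"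
    using assms by (intro member_le_sum) auto
  also have "\<dots> \<le> frob_sq M"
    unfolding frob_sq_def using assms by (intro member_le_sum) (auto intro: sum_nonneg)
  finally show ?thesis .
qed

text \<open>Multiplying by \<open>mat_adjoint U\<close> on the left and by the other unitary
  \<open>V\<close> on the right preserves the Frobenius norm. With
  \<open>W = mat_adjoint U * V\<close>, entry \<open>(i, j)\<close> of the difference becomes
  \<open>(d i - e j)\<close> times that of \<open>W\<close>. The weights come from the eigenvectors
  alone, so they survive when a function is applied to the eigenvalues.\<close>

lemma frob_sq_diff_diagonalizes:
  assumes M: "diagonalizes n U d M" and N: "diagonalizes n V e N"
  shows "frob_sq (M - N) =
    (\<Sum>j<n. \<Sum>i<n. (d i - e j)\<^sup>2 * (cmod ((mat_adjoint U * V) $$ (i, j)))\<^sup>2)"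
proof -
  note D = diagonalizesD[OF M] and E = diagonalizesD[OF N]
  define W where "W = mat_adjoint U * V"
  have W: "W \<in> carrier_mat n n" using D E by (simp add: W_def)
  have "frob_sq (M - N) = frob_sq (mat_adjoint U * (M - N) * V)"
    using D E by (simp add: frob_sq_unitary_left[of _ n] frob_sq_unitary_right[of _ n] unitary_adjoint)
  also have "mat_adjoint U * (M - N) * V = mat_adjoint U * M * V - mat_adjoint U * N * V"
    using D(1,4) E(1,4) by (simp add: mult_minus_distrib_mat[of _ n n] minus_mult_distrib_mat[of _ n n])
  also have "mat_adjoint U * M * V = (mat_adjoint U * U) * real_diag n d * W"
    using D(1) E(1) by (simp add: D(3) W_def square_mult_assoc[of _ n])
  also have "\<dots> = real_diag n d * W"
    using D W by (simp add: unitaryD[of U n] left_mult_one_mat[of _ n n])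
  also have "mat_adjoint U * N * V = W * real_diag n e * (mat_adjoint V * V)"
    using D(1) E(1) by (simp add: E(3) W_def square_mult_assoc[of _ n])
  also have "\<dots> = W * real_diag n e"
    using W E by (simp add: unitaryD[of V n] right_mult_one_mat[of _ n n])
  also have "frob_sq (real_diag n d * W - W * real_diag n e) =
      (\<Sum>j<n. \<Sum>i<n. (d i - e j)\<^sup>2 * (cmod (W $$ (i, j)))\<^sup>2)"
  proof -
    have "(cmod ((real_diag n d * W - W * real_diag n e) $$ (i, j)))\<^sup>2 = (d i - e j)\<^sup>2 * (cmod (W $$ (i, j)))\<^sup>2"
      if "i < n" "j < n" for i j
    proof -
      have "(real_diag n d * W - W * real_diag n e) $$ (i, j) = complex_of_real (d i - e j) * W $$ (i, j)"
        using that W real_diag_mult_index[OF W that, of d] real_diag_mult_index[OF W that, of e]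
        by (simp add: left_diff_distrib del: index_mult_mat(1))
      then show ?thesis by (simp only: norm_mult power_mult_distrib norm_of_real power2_abs)
    qed
    then show ?thesis using W by (simp add: frob_sq_def)
  qed
  finally show ?thesis by (simp add: W_def)
qed

lemma frob_sq_eq_0_imp:
  assumes "frob_sq (M - N) = 0" "M \<in> carrier_mat n n" "N \<in> carrier_mat n n"
  shows "M = N"
proof (rule eq_matI)
  fix i j assume "i < dim_row N" "j < dim_col N"
  then show "M $$ (i, j) = N $$ (i, j)"
    using cmod_index_le_frob_sq[of i "M - N" j] assms by auto
qed (use assms in auto)

text \<open>The same form of choice as in \<open>mat_powr\<close>, but for any real function and
  without a positivity condition, so that truncated powers make sense at every Hermitian
  matrix.\<close>

definition fcalc :: "(real \<Rightarrow> real) \<Rightarrow> complex mat \<Rightarrow> complex mat" where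
  "fcalc g M = (SOME X. \<exists>U d. diagonalizes (dim_row M) U d M \<and> diagonalizes (dim_row M) U (\<lambda>i. g (d i)) X)"

text \<open>The matrix $W = U^* V$ only links indices with equal eigenvalues, hence the functional calculus
  does not depend on the chosen diagonalization.\<close>
lemma diagonalizes_fun_unique:
  assumes M: "diagonalizes n U d M" and M': "diagonalizes n V e M"
    and X: "diagonalizes n U (\<lambda>i. g (d i)) X" and Y: "diagonalizes n V (\<lambda>i. g (e i)) Y"
  shows "X = Y"
proof -
  have "frob_sq (M - M) = 0"
    by (simp add: frob_sq_def)
  then have "(\<Sum>j<n. \<Sum>i<n. (d i - e j)\<^sup>2 * (cmod ((mat_adjoint U * V) $$ (i, j)))\<^sup>2) = 0"
    using frob_sq_diff_diagonalizes[OF M M'] by simp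
  then have "\<forall>j<n. \<forall>i<n. (d i - e j)\<^sup>2 * (cmod ((mat_adjoint U * V) $$ (i, j)))\<^sup>2 = 0"
    by (auto simp: sum_nonneg_eq_0_iff sum_nonneg simp del: mult_eq_0_iff)
  then have "d i = e j \<or> (mat_adjoint U * V) $$ (i, j) = 0" if "i < n" "j < n" for i j
    using that by auto
  then have "(g (d i) - g (e j))\<^sup>2 * (cmod ((mat_adjoint U * V) $$ (i, j)))\<^sup>2 = 0" if "i < n" "j < n" for i j
    using that by fastforce
  then have "(\<Sum>j<n. \<Sum>i<n. (g (d i) - g (e j))\<^sup>2 * (cmod ((mat_adjoint U * V) $$ (i, j)))\<^sup>2) = 0"
    by (intro sum.neutral ballI) auto
  then have "frob_sq (X - Y) = 0"
    using frob_sq_diff_diagonalizes[OF X Y] by simp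
  then show ?thesis
    using diagonalizesD(4)[OF X] diagonalizesD(4)[OF Y] by (rule frob_sq_eq_0_imp)
qed

lemma diagonalizes_fcalc:
  assumes M: "diagonalizes n U d M"
  shows "diagonalizes n U (\<lambda>i. g (d i)) (fcalc g M)"
proof -
  note D = diagonalizesD[OF M]
  define X where "X = U * real_diag n (\<lambda>i. g (d i)) * mat_adjoint U"
  have X: "diagonalizes n U (\<lambda>i. g (d i)) X" using D by (simp add: diagonalizes_def X_def)
  have n: "dim_row M = n" using D by auto
  have "\<exists>U d. diagonalizes (dim_row M) U d M \<and> diagonalizes (dim_row M) U (\<lambda>i. g (d i)) (fcalc g M)"
    unfolding fcalc_def by (rule someI_ex) (use M X n in auto)
  then show ?thesis
    using diagonalizes_fun_unique[OF M _ X] X n by metis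
qed

lemma fcalc_eqI:
  assumes "diagonalizes n U d M" "diagonalizes n U e X" "\<And>i. i < n \<Longrightarrow> e i = g (d i)"
  shows "fcalc g M = X"
proof -
  have "real_diag n e = real_diag n (\<lambda>i. g (d i))"
    using assms(3) by (intro eq_matI) (auto simp: real_diag_def)
  then show ?thesis
    using diagonalizesD[OF diagonalizes_fcalc[OF assms(1), of g]] diagonalizesD[OF assms(2)] by simp
qed

text \<open>The given diagonalization shows that the choice in \<open>mat_powr\<close> has a
  witness. The choice itself may rest on a different one, and uniqueness of the functional calculus
  reconciles the two.\<close>

lemma mat_powr_eq_fcalc:
  assumes M: "diagonalizes n U d M" and pos: "\<And>i. i < n \<Longrightarrow> d i > 0"
  shows "mat_powr M r = fcalc (\<lambda>x. x powr r) M"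
proof -
  note D = diagonalizesD[OF M]
  have n: "dim_row M = n" using D by auto
  define P where "P = (\<lambda>X. \<exists>U d. U \<in> carrier_mat (dim_row M) (dim_row M) \<and> unitary U \<and>
       (\<forall>i < dim_row M. d i > 0) \<and>
       M = U * real_diag (dim_row M) d * mat_adjoint U \<and>
       X = U * real_diag (dim_row M) (\<lambda>i. d i powr r) * mat_adjoint U)"
  have "P (U * real_diag (dim_row M) (\<lambda>i. d i powr r) * mat_adjoint U)"
    unfolding P_def n using D(1-3) pos by (intro exI[of _ U] exI[of _ d] conjI allI impI refl)
  then have "P (mat_powr M r)"
    unfolding mat_powr_def P_def[symmetric] by (rule someI)
  then obtain V e where V: "diagonalizes n V e M" "diagonalizes n V (\<lambda>i. e i powr r) (mat_powr M r)"
    unfolding P_def n diagonalizes_def by blast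
  then show ?thesis
    using fcalc_eqI[OF V, of "\<lambda>x. x powr r"] by simp
qed

lemma hermitian_diagonalizes:
  assumes "M \<in> carrier_mat n n" "hermitian M"
  obtains U d where "diagonalizes n U d M"
  using hermitian_spectral[OF assms] by (auto simp: diagonalizes_def)

text \<open>Both sides are sums with the same nonnegative weights, so the scalar estimate applies
  term by term. For the spectral norm the same constant would fail in general.\<close>

lemma frob_sq_fcalc_lipschitz:
  assumes M: "M \<in> carrier_mat n n" "hermitian M" and N: "N \<in> carrier_mat n n" "hermitian N"
    and g: "\<And>x y. \<bar>g x - g y\<bar> \<le> L * \<bar>x - y\<bar>"
  shows "frob_sq (fcalc g M - fcalc g N) \<le> L\<^sup>2 * frob_sq (M - N)"
proof -
  obtain U d where U: "diagonalizes n U d M" using hermitian_diagonalizes[OF M] .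
  obtain V e where V: "diagonalizes n V e N" using hermitian_diagonalizes[OF N] .
  have "(g x - g y)\<^sup>2 \<le> L\<^sup>2 * (x - y)\<^sup>2" for x y
    using power_mono[OF g[of x y], of 2] by (simp add: power_mult_distrib)
  then have "(g x - g y)\<^sup>2 * z\<^sup>2 \<le> L\<^sup>2 * ((x - y)\<^sup>2 * z\<^sup>2)" for x y z
    using mult_right_mono[of _ _ "z\<^sup>2"] by (simp add: mult.assoc[symmetric])
  then show ?thesis
    unfolding frob_sq_diff_diagonalizes[OF U V] sum_distrib_left
      frob_sq_diff_diagonalizes[OF diagonalizes_fcalc[OF U] diagonalizes_fcalc[OF V]]
    by (intro sum_mono) auto
qed

section \<open>Quadratic forms and the Loewner--Heinz inequality\<close>

lemma diagonalizes_mult_col: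
  assumes "diagonalizes n U d M" "i < n"
  shows "col U i \<in> carrier_vec n" "vnorm (col U i) = 1" "col U i \<noteq> 0\<^sub>v n"
    "M *\<^sub>v col U i = complex_of_real (d i) \<cdot>\<^sub>v col U i" "qform M (col U i) = d i"
proof -
  note D = diagonalizesD[OF assms(1)]
  show c: "col U i \<in> carrier_vec n" using D assms by simp
  have u: "mat_adjoint U *\<^sub>v col U i = unit_vec n i"
  proof -
    have "mat_adjoint U *\<^sub>v col U i = col (mat_adjoint U * U) i"
      by (rule col_mult2[of _ n n _ n, symmetric]) (use D assms in auto)
    then show ?thesis using D assms by (simp add: unitaryD)
  qed
  have "(vnorm (col U i))\<^sup>2 = 1"
    unfolding vnorm_eq_sum_unitary[OF D(1,2) c] u using assms(2)
    by (auto simp: if_distrib[of cmod] if_distrib[of "\<lambda>x. x\<^sup>2"] cong: if_cong)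
  then show 1: "vnorm (col U i) = 1" by (simp add: power2_eq_1_iff) (metis vnorm_nonneg not_one_le_zero neg_0_le_iff_le)
  show "col U i \<noteq> 0\<^sub>v n" using 1 vnorm_eq_0_iff[OF c] by auto
  have "M *\<^sub>v col U i = U *\<^sub>v (real_diag n d *\<^sub>v unit_vec n i)"
    using D c u by (simp add: assoc_mult_mat_vec[of _ n n _ n])
  also have "real_diag n d *\<^sub>v unit_vec n i = complex_of_real (d i) \<cdot>\<^sub>v unit_vec n i"
  proof (rule eq_vecI)
    fix j assume "j < dim_vec (complex_of_real (d i) \<cdot>\<^sub>v unit_vec n i)"
    then show "(real_diag n d *\<^sub>v unit_vec n i) $ j = (complex_of_real (d i) \<cdot>\<^sub>v unit_vec n i) $ j"
      using assms(2) real_diag_mult_vec[of "unit_vec n i" n j d] by auto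
  qed simp
  also have "U *\<^sub>v \<dots> = complex_of_real (d i) \<cdot>\<^sub>v (U *\<^sub>v unit_vec n i)"
    using D by (intro mult_mat_vec[of _ n n]) auto
  also have "U *\<^sub>v unit_vec n i = col U i"
    using D assms(2) by (intro eq_vecI) (auto simp: scalar_prod_right_unit)
  finally show "M *\<^sub>v col U i = complex_of_real (d i) \<cdot>\<^sub>v col U i" .
  show "qform M (col U i) = d i"
    unfolding qform_diagonalizes[OF assms(1) c] u using assms(2)
    by (auto simp: if_distrib[of cmod] if_distrib[of "\<lambda>x. x\<^sup>2"] if_distrib[of "\<lambda>x. _ * x"] cong: if_cong)
qed

lemma qform_ge_if_eigenvalues_ge:
  assumes "diagonalizes n U d M" "v \<in> carrier_vec n" "\<And>i. i < n \<Longrightarrow> c \<le> d i"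
  shows "c * (vnorm v)\<^sup>2 \<le> qform M v"
  unfolding qform_diagonalizes[OF assms(1,2)] sum_distrib_left
    vnorm_eq_sum_unitary[OF diagonalizesD(1,2)[OF assms(1)] assms(2)]
  using assms(3) by (intro sum_mono mult_right_mono) auto

lemma qform_le_if_eigenvalues_le:
  assumes "diagonalizes n U d M" "v \<in> carrier_vec n" "\<And>i. i < n \<Longrightarrow> d i \<le> c"
  shows "qform M v \<le> c * (vnorm v)\<^sup>2"
  unfolding qform_diagonalizes[OF assms(1,2)] sum_distrib_left
    vnorm_eq_sum_unitary[OF diagonalizesD(1,2)[OF assms(1)] assms(2)]
  using assms(3) by (intro sum_mono mult_right_mono) auto

lemma qform_minus:
  assumes "M \<in> carrier_mat n n" "N \<in> carrier_mat n n" "v \<in> carrier_vec n"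
  shows "qform (M - N) v = qform M v - qform N v"
  using assms by (simp add: qform_def minus_mult_distrib_mat_vec[of _ n n] minus_scalar_prod_distrib[of _ n])

lemma qform_adjoint_mult:
  assumes "M \<in> carrier_mat n n" "A \<in> carrier_mat n n" "v \<in> carrier_vec n"
  shows "qform (mat_adjoint A * M * A) v = qform M (A *\<^sub>v v)"
proof -
  have "mat_adjoint A * M * A *\<^sub>v v = mat_adjoint A *\<^sub>v (M *\<^sub>v (A *\<^sub>v v))"
    using assms by (simp add: assoc_mult_mat_vec[of _ n n _ n])
  then show ?thesis
    using assms by (simp add: qform_def cscalar_prod_mult_mat_vec[of _ n n])
qed

lemma loewner_le_iff:
  assumes "M \<in> carrier_mat n n" "hermitian M" "N \<in> carrier_mat n n" "hermitian N"
  shows "loewner_le M N \<longleftrightarrow> (\<forall>v\<in>carrier_vec n. qform M v \<le> qform N v)"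
proof -
  have "hermitian (N - M)"
    using assms by (simp add: hermitian_def mat_adjoint_minus[of _ n n])
  then show ?thesis
    using assms by (auto simp: loewner_le_def pos_semidef_def qform_minus[of _ n])
qed

section \<open>Positive definite matrices and their real powers\<close>

lemma PD_diagonalizes:
  assumes "M \<in> PD n"
  obtains U d where "diagonalizes n U d M" "\<And>i. i < n \<Longrightarrow> d i > 0"
proof -
  have M: "M \<in> carrier_mat n n" "hermitian M" and pos: "\<And>v. v \<in> carrier_vec n \<Longrightarrow> v \<noteq> 0\<^sub>v n \<Longrightarrow> qform M v > 0"
    using assms by (auto simp: PD_def pos_def_def)
  obtain U d where D: "diagonalizes n U d M" using hermitian_diagonalizes[OF M] .
  have "d i > 0" if "i < n" for i
    using pos[of "col U i"] diagonalizes_mult_col[OF D that] by simp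
  with D show ?thesis using that by blast
qed

lemma PD_I:
  assumes D: "diagonalizes n U d M" and pos: "\<And>i. i < n \<Longrightarrow> d i > 0"
  shows "M \<in> PD n"
proof -
  have "qform M v > 0" if v: "v \<in> carrier_vec n" "v \<noteq> 0\<^sub>v n" for v
  proof -
    have "n \<noteq> 0" using v by auto
    then have n: "{..<n} \<noteq> {}" by auto
    \<comment> \<open>A nonzero vector exists only in positive dimension, so the minimum is over a
      nonempty set.\<close>
    define c where "c = Min (d ` {..<n})"
    have "c > 0" using n pos by (auto simp: c_def)
    moreover have "c \<le> d i" if "i < n" for i using that by (auto simp: c_def)
    ultimately show ?thesis
      using qform_ge_if_eigenvalues_ge[OF D v(1), of c] vnorm_eq_0_iff[OF v(1)] v(2)
      by (metis less_le_trans mult_pos_pos zero_less_power2)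
  qed
  then show ?thesis
    using diagonalizesD(4)[OF D] diagonalizes_hermitian[OF D] by (auto simp: PD_def pos_def_def)
qed

lemma diagonalizes_mat_powr:
  assumes "diagonalizes n U d M" "\<And>i. i < n \<Longrightarrow> d i > 0"
  shows "diagonalizes n U (\<lambda>i. d i powr r) (mat_powr M r)"
  using diagonalizes_fcalc[OF assms(1), of "\<lambda>x. x powr r"] mat_powr_eq_fcalc[OF assms] by simp

lemma mat_powr_PD [simp]: "M \<in> PD n \<Longrightarrow> mat_powr M r \<in> PD n"
  by (metis PD_diagonalizes PD_I diagonalizes_mat_powr powr_gt_zero less_numeral_extra(3))

lemma PD_carrier [simp]: "M \<in> PD n \<Longrightarrow> M \<in> carrier_mat n n"
  and PD_hermitian [simp]: "M \<in> PD n \<Longrightarrow> hermitian M"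
  by (auto simp: PD_def pos_def_def)

lemma diagonalizes_mult:
  assumes M: "diagonalizes n U d M" and N: "diagonalizes n U e N"
  shows "diagonalizes n U (\<lambda>i. d i * e i) (M * N)"
proof -
  note D = diagonalizesD[OF M] and E = diagonalizesD[OF N]
  have "M * N = U * real_diag n d * (mat_adjoint U * U) * real_diag n e * mat_adjoint U"
    using D(1) by (simp add: D(3) E(3) square_mult_assoc[of _ n])
  also have "\<dots> = U * (real_diag n d * real_diag n e) * mat_adjoint U"
    using D(1,2) by (simp add: unitaryD[of U n] right_mult_one_mat[of _ n n] square_mult_assoc[of _ n])
  finally show ?thesis
    using D(1,2) by (simp add: diagonalizes_def real_diag_mult)
qed

lemma diagonalizes_cong:
  assumes "diagonalizes n U d M" "diagonalizes n U e N" "\<And>i. i < n \<Longrightarrow> d i = e i"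
  shows "M = N"
proof -
  have "real_diag n d = real_diag n e" using assms(3) by (intro eq_matI) (auto simp: real_diag_def)
  then show ?thesis using diagonalizesD(3)[OF assms(1)] diagonalizesD(3)[OF assms(2)] by simp
qed

lemma mat_powr_add:
  assumes "M \<in> PD n"
  shows "mat_powr M r * mat_powr M s = mat_powr M (r + s)"
proof -
  obtain U d where D: "diagonalizes n U d M" "\<And>i. i < n \<Longrightarrow> d i > 0"
    using PD_diagonalizes[OF assms] by blast
  show ?thesis
    by (rule diagonalizes_cong[OF diagonalizes_mult[OF diagonalizes_mat_powr[OF D] diagonalizes_mat_powr[OF D]]
          diagonalizes_mat_powr[OF D]]) (simp_all add: powr_add)
qed

lemma mat_powr_one:
  assumes "M \<in> PD n"
  shows "mat_powr M 1 = M"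
proof -
  obtain U d where D: "diagonalizes n U d M" "\<And>i. i < n \<Longrightarrow> d i > 0"
    using PD_diagonalizes[OF assms] by blast
  have "d i powr 1 = d i" if "i < n" for i
    using D(2)[OF that] by simp
  then show ?thesis
    using diagonalizes_cong[OF diagonalizes_mat_powr[OF D] D(1)] by blast
qed

lemma mat_powr_zero:
  assumes "M \<in> PD n"
  shows "mat_powr M 0 = 1\<^sub>m n"
proof -
  obtain U d where D: "diagonalizes n U d M" "\<And>i. i < n \<Longrightarrow> d i > 0"
    using PD_diagonalizes[OF assms] by blast
  have "real_diag n (\<lambda>i. 1) = 1\<^sub>m n" by (intro eq_matI) (auto simp: real_diag_def)
  then have 1: "diagonalizes n U (\<lambda>i. 1) (1\<^sub>m n)"
    using diagonalizesD(1,2)[OF D(1)] by (simp add: diagonalizes_def right_mult_one_mat[of _ n n] unitaryD)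
  \<comment> \<open>Positivity matters here: \<open>0 powr 0\<close> is 0, so
    \<open>d i powr 0 = 1\<close> requires a nonzero \<open>d i\<close>.\<close>
  show ?thesis
    by (rule diagonalizes_cong[OF diagonalizes_mat_powr[OF D] 1]) (use D(2) in force)+
qed

lemma mat_powr_mult_vec:
  assumes "M \<in> PD n" "v \<in> carrier_vec n"
  shows "mat_powr M r *\<^sub>v (mat_powr M s *\<^sub>v v) = mat_powr M (r + s) *\<^sub>v v"
  using assms by (simp add: assoc_mult_mat_vec[of _ n n _ n, symmetric] mat_powr_add)

text \<open>Powers are self-adjoint, so part of an exponent can move to the other argument. The
  midpoint argument below needs the unequal split into \<open>r\<close> and
  \<open>s\<close>.\<close>

lemma mat_powr_cscalar_prod:
  assumes "M \<in> PD n" "v \<in> carrier_vec n" "w \<in> carrier_vec n"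
  shows "(mat_powr M (r + s) *\<^sub>v v) \<bullet>c w = (mat_powr M r *\<^sub>v v) \<bullet>c (mat_powr M s *\<^sub>v w)"
  using assms cscalar_prod_mult_mat_vec[of "mat_powr M s" n n "mat_powr M r *\<^sub>v v" w]
    hermitianD[OF PD_hermitian[OF mat_powr_PD[OF assms(1)]], of s]
  by (simp add: mat_powr_mult_vec add.commute)

lemma qform_mat_powr:
  assumes "M \<in> PD n" "v \<in> carrier_vec n"
  shows "qform (mat_powr M r) v = (vnorm (mat_powr M (r / 2) *\<^sub>v v))\<^sup>2"
  using mat_powr_cscalar_prod[OF assms assms(2), of "r / 2" "r / 2"]
  by (simp add: qform_def Re_cscalar_prod_self)

lemma Re_cscalar_prod_le:
  assumes "v \<in> carrier_vec n" "w \<in> carrier_vec n"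
  shows "Re (v \<bullet>c w) \<le> vnorm v * vnorm w"
proof -
  have "Re (v \<bullet>c w) \<le> cmod (\<Sum>i<n. v $ i * cnj (w $ i))"
  proof -
    have "v \<bullet>c w = (\<Sum>i<n. v $ i * cnj (w $ i))"
      using assms by (simp add: scalar_prod_def atLeast0LessThan)
    then show ?thesis by (simp only: complex_Re_le_cmod)
  qed
  also have "\<dots> \<le> (\<Sum>i<n. \<bar>cmod (v $ i)\<bar> * \<bar>cmod (w $ i)\<bar>)"
    by (rule order_trans[OF norm_sum]) (simp add: norm_mult)
  also have "\<dots> \<le> L2_set (\<lambda>i. cmod (v $ i)) {..<n} * L2_set (\<lambda>i. cmod (w $ i)) {..<n}"
    by (rule L2_set_mult_ineq)
  also have "\<dots> = vnorm v * vnorm w"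
    using assms vnorm_sq[of v] vnorm_sq[of w] by (simp add: L2_set_def real_sqrt_unique)
  finally show ?thesis .
qed

text \<open>With \<open>a\<close> the midpoint, it suffices that every eigenvalue of
  \<open>T = R^(-a/2) P^a R^(-a/2)\<close> is at most 1. An eigenvector of \<open>T\<close> yields a
  vector \<open>w\<close> with \<open>P^a w = e R^a w\<close>. Pairing this with a suitable
  \<open>u\<close> and splitting \<open>a\<close> as \<open>r/2 + s/2\<close> lets Cauchy-Schwarz
  bring in one hypothesis for each factor.\<close>

lemma qform_mat_powr_midpoint:
  assumes P: "P \<in> PD n" and R: "R \<in> PD n"
    and r: "\<And>v. v \<in> carrier_vec n \<Longrightarrow> qform (mat_powr P r) v \<le> qform (mat_powr R r) v"
    and s: "\<And>v. v \<in> carrier_vec n \<Longrightarrow> qform (mat_powr P s) v \<le> qform (mat_powr R s) v"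
    and v: "v \<in> carrier_vec n"
  shows "qform (mat_powr P ((r + s) / 2)) v \<le> qform (mat_powr R ((r + s) / 2)) v"
proof -
  define a where "a = (r + s) / 2"
  define S where "S = mat_powr R (- a / 2)"
  have S: "S \<in> PD n" using R by (simp add: S_def)
  have adjS: "mat_adjoint S = S" by (rule hermitianD[OF PD_hermitian[OF S]])
  define T where "T = mat_adjoint S * mat_powr P a * S"
  have T: "T \<in> carrier_mat n n" using S P by (simp add: T_def)
  have "hermitian T" unfolding T_def using S P by (intro hermitian_adjoint_mult[of _ n] PD_hermitian[of _ n]) auto
  then obtain V e where D: "diagonalizes n V e T" using hermitian_diagonalizes[OF T] by blast
  have "e i \<le> 1" if i: "i < n" for i
  proof -
    note c = diagonalizes_mult_col[OF D i]
    define w where "w = S *\<^sub>v col V i"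
    \<comment> \<open>The exponent is chosen so that \<open>R^(s/2) u = R^(r/2) w\<close>. Both
      factors of the Cauchy-Schwarz bound are then at most the same number \<open>N\<close>, and
      pairing \<open>R^a w\<close> with \<open>u\<close> gives \<open>N\<close> squared.\<close>
    define u where "u = mat_powr R ((r - s) / 2) *\<^sub>v w"
    have w: "w \<in> carrier_vec n" using S c by (simp add: w_def)
    have u: "u \<in> carrier_vec n" using R w by (simp add: u_def)
    have colV: "col V i = mat_powr R (a / 2) *\<^sub>v w"
      using R c by (simp add: w_def S_def mat_powr_mult_vec mat_powr_zero)
    have "S *\<^sub>v (mat_powr P a *\<^sub>v w) = T *\<^sub>v col V i"
      using S P c by (simp add: T_def adjS w_def assoc_mult_mat_vec[of _ n n _ n])
    also have "\<dots> = complex_of_real (e i) \<cdot>\<^sub>v col V i" by (rule c(4))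
    finally have "mat_powr R (a / 2) *\<^sub>v (S *\<^sub>v (mat_powr P a *\<^sub>v w)) =
        complex_of_real (e i) \<cdot>\<^sub>v (mat_powr R (a / 2) *\<^sub>v col V i)"
      using R c by (simp add: mult_mat_vec[of _ n n])
    \<comment> \<open>After cancelling \<open>R^(a/2)\<close> against \<open>S\<close>, the
      eigenvalue equation of \<open>T\<close> is a generalized eigenvalue equation for
      \<open>P^a\<close> and \<open>R^a\<close>.\<close>
    then have gen: "mat_powr P a *\<^sub>v w = complex_of_real (e i) \<cdot>\<^sub>v (mat_powr R a *\<^sub>v w)"
      using R P w by (simp add: S_def mat_powr_mult_vec mat_powr_zero colV)
    define N where "N = vnorm (mat_powr R (r / 2) *\<^sub>v w)"
    have "mat_powr R (s / 2) *\<^sub>v u = mat_powr R (r / 2) *\<^sub>v w"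
      using R w by (simp add: u_def mat_powr_mult_vec diff_divide_distrib)
    then have Nu: "vnorm (mat_powr R (s / 2) *\<^sub>v u) = N" by (simp add: N_def)
    have aa: "a = r / 2 + s / 2" by (simp add: a_def add_divide_distrib)
    have "(mat_powr R a *\<^sub>v w) \<bullet>c u = (mat_powr R (r / 2) *\<^sub>v w) \<bullet>c (mat_powr R (r / 2) *\<^sub>v w)"
      unfolding aa mat_powr_cscalar_prod[OF R w u] \<open>mat_powr R (s / 2) *\<^sub>v u = _\<close> ..
    then have "e i * N\<^sup>2 = Re ((mat_powr P a *\<^sub>v w) \<bullet>c u)"
      using R w u by (simp add: gen N_def Re_cscalar_prod_self smult_scalar_prod_distrib[of _ n])
    also have "\<dots> = Re ((mat_powr P (r / 2) *\<^sub>v w) \<bullet>c (mat_powr P (s / 2) *\<^sub>v u))"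
      unfolding aa mat_powr_cscalar_prod[OF P w u] ..
    also have "\<dots> \<le> vnorm (mat_powr P (r / 2) *\<^sub>v w) * vnorm (mat_powr P (s / 2) *\<^sub>v u)"
      using P w u by (intro Re_cscalar_prod_le[of _ n]) auto
    also have "\<dots> \<le> N * N"
    proof (rule mult_mono)
      show "vnorm (mat_powr P (r / 2) *\<^sub>v w) \<le> N"
        using r[OF w] P R w by (simp add: qform_mat_powr N_def)
      show "vnorm (mat_powr P (s / 2) *\<^sub>v u) \<le> N"
        using s[OF u] P R u by (simp add: qform_mat_powr Nu N_def)
    qed (auto simp: N_def)
    finally have "e i * N\<^sup>2 \<le> 1 * N\<^sup>2" by (simp add: power2_eq_square)
    \<comment> \<open>A power of \<open>R\<close> carries \<open>R^(r/2) w\<close> to the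
      eigenvector \<open>col V i\<close>, which is nonzero.\<close>
    moreover have "N \<noteq> 0"
    proof
      assume "N = 0"
      then have "mat_powr R (r / 2) *\<^sub>v w = 0\<^sub>v n"
        using R w by (simp add: N_def vnorm_eq_0_iff[of _ n])
      then have "mat_powr R (a / 2 - r / 2) *\<^sub>v (mat_powr R (r / 2) *\<^sub>v w) = 0\<^sub>v n"
        by (intro eq_vecI) (auto simp: scalar_prod_def carrier_matD[OF PD_carrier[OF mat_powr_PD[OF R]]])
      then show False using R w c(3) by (simp add: mat_powr_mult_vec colV)
    qed
    ultimately show ?thesis by (simp add: mult_le_cancel_right)
  qed
  \<comment> \<open>Evaluating \<open>T\<close> at \<open>R^(a/2) v\<close> undoes the congruence by
    \<open>S\<close>.\<close>
  then have "qform T (mat_powr R (a / 2) *\<^sub>v v) \<le> 1 * (vnorm (mat_powr R (a / 2) *\<^sub>v v))\<^sup>2"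
    using R v by (intro qform_le_if_eigenvalues_le[OF D]) auto
  moreover have "qform T (mat_powr R (a / 2) *\<^sub>v v) = qform (mat_powr P a) v"
    using P R S v by (simp add: T_def qform_adjoint_mult[of _ n] S_def mat_powr_mult_vec mat_powr_zero)
  ultimately show ?thesis
    using R v by (simp add: qform_mat_powr a_def)
qed

text \<open>In a fixed eigenbasis of \<open>M\<close> only the factors \<open>d i powr r\<close>
  depend on the exponent.\<close>

lemma continuous_qform_mat_powr:
  assumes "M \<in> PD n" "v \<in> carrier_vec n"
  shows "continuous_on UNIV (\<lambda>r. qform (mat_powr M r) v)"
proof -
  obtain U d where D: "diagonalizes n U d M" "\<And>i. i < n \<Longrightarrow> d i > 0"
    using PD_diagonalizes[OF assms(1)] by blast
  have "continuous_on UNIV (\<lambda>r. \<Sum>i<n. d i powr r * (cmod ((mat_adjoint U *\<^sub>v v) $ i))\<^sup>2)"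
    using D(2) by (intro continuous_intros) fastforce+
  then show ?thesis
    using qform_diagonalizes[OF diagonalizes_mat_powr[OF D] assms(2)] by simp
qed

text \<open>A missing point \<open>r\<close> would lie in a gap of \<open>E\<close> with endpoints
  \<open>l\<close> and \<open>u\<close> in \<open>E\<close>, since \<open>E\<close> is closed. Their
  midpoint lies in \<open>E\<close> and strictly inside the gap.\<close>

lemma closed_midpoint_interval:
  fixes E :: "real set"
  assumes E: "closed E" and mid: "\<And>x y. x \<in> E \<Longrightarrow> y \<in> E \<Longrightarrow> (x + y) / 2 \<in> E"
    and ab: "a \<in> E" "b \<in> E" and r: "a \<le> r" "r \<le> b"
  shows "r \<in> E"
proof (rule ccontr)
  assume nr: "r \<notin> E"
  define l where "l = Sup (E \<inter> {a..r})"
  define u where "u = Inf (E \<inter> {r..b})"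
  have "l \<in> E \<inter> {a..r}"
    unfolding l_def using E ab r by (intro closed_contains_Sup) (auto intro: closed_Int)
  moreover have "u \<in> E \<inter> {r..b}"
    unfolding u_def using E ab r by (intro closed_contains_Inf) (auto intro: closed_Int)
  moreover have "x \<le> l" if "x \<in> E" "a \<le> x" "x \<le> r" for x
    unfolding l_def using that by (intro cSup_upper) auto
  moreover have "u \<le> x" if "x \<in> E" "r \<le> x" "x \<le> b" for x
    unfolding u_def using that by (intro cInf_lower) auto
  ultimately have lu: "l \<in> E" "u \<in> E" "a \<le> l" "l < r" "r < u" "u \<le> b"
    and l: "\<And>x. x \<in> E \<Longrightarrow> a \<le> x \<Longrightarrow> x \<le> r \<Longrightarrow> x \<le> l" and u: "\<And>x. x \<in> E \<Longrightarrow> r \<le> x \<Longrightarrow> x \<le> b \<Longrightarrow> u \<le> x"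
    using nr by (auto simp: less_le)
  define m where "m = (l + u) / 2"
  have "m \<in> E" "l < m" "m < u" using mid[OF lu(1,2)] lu by (auto simp: m_def)
  then show False
    using l[of m] u[of m] lu by (cases "m \<le> r") auto
qed

text \<open>Loewner--Heinz, after Pedersen: the admissible exponents form a closed, midpoint-closed set
  containing 0 and 1.\<close>
lemma qform_mat_powr_mono:
  assumes P: "P \<in> PD n" and R: "R \<in> PD n"
    and le: "\<And>v. v \<in> carrier_vec n \<Longrightarrow> qform P v \<le> qform R v"
    and r: "0 \<le> r" "r \<le> 1" and v: "v \<in> carrier_vec n"
  shows "qform (mat_powr P r) v \<le> qform (mat_powr R r) v"
proof -
  define E where "E = {r. \<forall>v\<in>carrier_vec n. qform (mat_powr P r) v \<le> qform (mat_powr R r) v}"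
  have "E = (\<Inter>v\<in>carrier_vec n. {r. qform (mat_powr P r) v \<le> qform (mat_powr R r) v})"
    by (auto simp: E_def)
  then have "closed E"
    using continuous_qform_mat_powr[OF P] continuous_qform_mat_powr[OF R]
    by (auto intro!: closed_INT closed_Collect_le)
  moreover have "(x + y) / 2 \<in> E" if "x \<in> E" "y \<in> E" for x y
    using that qform_mat_powr_midpoint[OF P R, of x y] by (auto simp: E_def)
  moreover have "0 \<in> E" "1 \<in> E"
    using P R le by (auto simp: E_def mat_powr_zero mat_powr_one)
  ultimately have "r \<in> E" using closed_midpoint_interval r by blast
  then show ?thesis using v by (simp add: E_def)
qed

section \<open>Extreme eigenvalues and the operator norm\<close>

lemma eigenvalue_in_spectrum:
  assumes "diagonalizes n U d M" "i < n"
  shows "complex_of_real (d i) \<in> spectrum M"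
  using diagonalizes_mult_col[OF assms] diagonalizesD(4)[OF assms(1)]
  by (auto simp: spectrum_def eigenvalue_def eigenvector_def intro!: exI[of _ "col U i"])

lemma lambda_bounds:
  assumes "diagonalizes n U d M" "i < n"
  shows "lambda_min M \<le> d i" "d i \<le> lambda_max M"
proof -
  have "d i \<in> Re ` spectrum M" using eigenvalue_in_spectrum[OF assms] by force
  moreover have "finite (Re ` spectrum M)"
    using card_finite_spectrum(1)[OF diagonalizesD(4)[OF assms(1)]] by simp
  ultimately show "lambda_min M \<le> d i" "d i \<le> lambda_max M"
    by (auto simp: lambda_min_def lambda_max_def)
qed

text \<open>In positive dimension the spectrum is nonempty and finite, so the minimum is attained.
  The attaining eigenvalue \<open>e\<close> is a priori complex; pairing \<open>M v\<close> with
  \<open>v\<close> shows that \<open>Re e\<close> has the sign of \<open>qform M v\<close>.\<close>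

lemma lambda_min_pos:
  assumes M: "M \<in> PD n" and n: "0 < n"
  shows "lambda_min M > 0"
proof -
  have "spectrum M \<noteq> {}" "finite (spectrum M)"
    using spectrum_non_empty[of M n] card_finite_spectrum(1)[of M n] M n by auto
  then have "lambda_min M \<in> Re ` spectrum M" unfolding lambda_min_def by (intro Min_in) auto
  then obtain e v where e: "lambda_min M = Re e" and v: "v \<in> carrier_vec n" "v \<noteq> 0\<^sub>v n" "M *\<^sub>v v = e \<cdot>\<^sub>v v"
    using PD_carrier[OF M] by (auto simp: spectrum_def eigenvalue_def eigenvector_def)
  have "\<forall>w\<in>carrier_vec n. w \<noteq> 0\<^sub>v n \<longrightarrow> 0 < qform M w"
    using M by (auto simp: PD_def pos_def_def simp del: PD_carrier PD_hermitian)
  with v(1,2) have "0 < qform M v" by blast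
  also have "qform M v = Re e * (vnorm v)\<^sup>2"
  proof -
    have "v \<bullet>c v = complex_of_real ((vnorm v)\<^sup>2)"
      unfolding vnorm_sq of_real_sum
      by (auto simp: scalar_prod_def atLeast0LessThan complex_norm_square simp del: of_real_power intro!: sum.cong)
    then show ?thesis using v by (simp add: qform_def v(3))
  qed
  finally show ?thesis by (simp add: e zero_less_mult_iff)
qed

text \<open>\<open>op_norm\<close> is a real supremum, which bounds its members only once the set is
  known to be bounded above. That bound comes from diagonalizing \<open>mat_adjoint A * A\<close>,
  written with the identity in the middle to fit the congruence lemmas.\<close>

lemma vnorm_mult_le_op_norm:
  assumes A: "A \<in> carrier_mat n n" and v: "v \<in> carrier_vec n"
  shows "vnorm (A *\<^sub>v v) \<le> op_norm A * vnorm v"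
proof -
  have one: "hermitian (1\<^sub>m n)" by (simp add: hermitian_def)
  have "hermitian (mat_adjoint A * 1\<^sub>m n * A)"
    using A one by (intro hermitian_adjoint_mult[of _ n]) auto
  moreover have "mat_adjoint A * 1\<^sub>m n * A \<in> carrier_mat n n" using A by simp
  ultimately obtain U d where D: "diagonalizes n U d (mat_adjoint A * 1\<^sub>m n * A)"
    using hermitian_diagonalizes by blast
  \<comment> \<open>Any common upper bound of the eigenvalues serves; this sum makes sense for every
    \<open>n\<close>, including 0.\<close>
  define c where "c = (\<Sum>i<n. \<bar>d i\<bar>)"
  have dc: "d i \<le> c" if "i < n" for i
    using member_le_sum[of i "{..<n}" "\<lambda>i. \<bar>d i\<bar>"] that by (auto simp: c_def)
  have bound: "(vnorm (A *\<^sub>v w))\<^sup>2 \<le> c * (vnorm w)\<^sup>2" if w: "w \<in> carrier_vec n" for w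
    using qform_le_if_eigenvalues_le[OF D w dc] A w
    by (simp only: qform_adjoint_mult[of "1\<^sub>m n" n A w] one_carrier_mat)
       (simp add: qform_def one_mult_mat_vec[of _ n] Re_cscalar_prod_self)
  define W where "W = {vnorm (A *\<^sub>v v) | v. v \<in> carrier_vec (dim_col A) \<and> vnorm v = 1}"
  have bdd: "bdd_above W"
  proof (rule bdd_aboveI)
    fix x assume "x \<in> W"
    then have "x\<^sup>2 \<le> c" using bound A by (force simp: W_def)
    then show "x \<le> sqrt c" by (rule real_le_rsqrt)
  qed
  show ?thesis
  proof (cases "vnorm v = 0")
    case True
    then have "(vnorm (A *\<^sub>v v))\<^sup>2 \<le> 0" using bound[OF v] by simp
    then show ?thesis using True by simp
  next
    case False
    define w where "w = complex_of_real (1 / vnorm v) \<cdot>\<^sub>v v"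
    have w: "w \<in> carrier_vec n" "vnorm w = 1"
      using v False by (simp_all add: w_def vnorm_smult norm_divide)
    have "vnorm (A *\<^sub>v w) \<le> op_norm A"
      unfolding op_norm_def W_def[symmetric] using bdd w A by (intro cSup_upper) (auto simp: W_def)
    also have "vnorm (A *\<^sub>v w) = vnorm (A *\<^sub>v v) / vnorm v"
      unfolding w_def using A v by (simp add: mult_mat_vec[of _ n n] vnorm_smult norm_divide)
    finally show ?thesis using False vnorm_nonneg[of v] by (simp add: pos_divide_le_eq less_le)
  qed
qed

section \<open>Fixed points\<close>

lemma tendsto_fun_componentwise:
  fixes X :: "nat \<Rightarrow> 'a::countable \<Rightarrow> real"
  assumes "X \<longlonglongrightarrow> x"
  shows "(\<lambda>k. X k i) \<longlonglongrightarrow> x i"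
  using continuous_on_tendsto_compose[OF continuous_on_product_coordinates[of i] assms] by auto

text \<open>Coordinates from \<open>N\<close> on are overwritten by 0, which places the sequence in
  a compact product. A countable product of lines is metrizable, so compactness gives a convergent
  subsequence.\<close>

lemma bounded_sequence_subseq_componentwise:
  fixes X :: "nat \<Rightarrow> nat \<Rightarrow> real"
  assumes "\<And>k j. j < N \<Longrightarrow> X k j \<in> {a..b}"
  obtains x r where "strict_mono (r :: nat \<Rightarrow> nat)" "\<And>j. j < N \<Longrightarrow> (\<lambda>k. X (r k) j) \<longlonglongrightarrow> x j"
proof -
  define K where "K = Pi\<^sub>E UNIV (\<lambda>j. if j < N then {a..b} else {0::real})"
  define Y where "Y = (\<lambda>k j. if j < N then X k j else 0)"
  have "compactin (product_topology (\<lambda>i. euclidean) UNIV) K"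
    unfolding K_def by (subst compactin_PiE) auto
  then have "compact K" by (simp add: euclidean_product_topology)
  then have sc: "seq_compact K" by (simp add: compact_eq_seq_compact_metric)
  have "\<forall>k. Y k \<in> K" using assms by (auto simp: Y_def K_def)
  then obtain x r where "strict_mono r" "(Y \<circ> r) \<longlonglongrightarrow> x"
    using sc unfolding seq_compact_def by metis
  moreover from this have "(\<lambda>k. X (r k) j) \<longlonglongrightarrow> x j" if "j < N" for j
    using tendsto_fun_componentwise[of "Y \<circ> r" x j] that by (simp add: Y_def)
  ultimately show ?thesis using that by blast
qed

text \<open>For each grid width, Kuhn's lemma yields a grid point near which, for every coordinate,
  \<open>f\<close> fails to decrease that coordinate at one point and fails to increase it at
  another. Any subsequential limit of these grid points is fixed. The hypothesis \<open>cont\<close>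
  is sequential continuity with respect to the first \<open>N\<close> coordinates.\<close>

lemma brouwer_unit_cube:
  fixes f :: "(nat \<Rightarrow> real) \<Rightarrow> nat \<Rightarrow> real"
  assumes maps: "\<And>x i. (\<And>j. j < N \<Longrightarrow> x j \<in> {0..1}) \<Longrightarrow> i < N \<Longrightarrow> f x i \<in> {0..1}"
    and cont: "\<And>X x i. (\<And>k j. j < N \<Longrightarrow> X k j \<in> {0..1}) \<Longrightarrow>
      (\<And>j. j < N \<Longrightarrow> (\<lambda>k::nat. X k j) \<longlonglongrightarrow> x j) \<Longrightarrow> i < N \<Longrightarrow> (\<lambda>k. f (X k) i) \<longlonglongrightarrow> f x i"
  obtains x where "\<And>j. j < N \<Longrightarrow> x j \<in> {0..1}" "\<And>i. i < N \<Longrightarrow> f x i = x i"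
proof -
  define cube where "cube = {x :: nat \<Rightarrow> real. \<forall>j<N. x j \<in> {0..1}}"
  have approx: "\<exists>q\<in>cube. \<forall>i<N. \<exists>r s. r \<in> cube \<and> s \<in> cube \<and>
      (\<forall>j<N. \<bar>r j - q j\<bar> \<le> 1 / real (Suc k)) \<and> (\<forall>j<N. \<bar>s j - q j\<bar> \<le> 1 / real (Suc k)) \<and>
      r i \<le> f r i \<and> f s i \<le> s i" for k
  proof -
    define p where "p = Suc k"
    define sc where "sc = (\<lambda>(y :: nat \<Rightarrow> nat) j. real (y j) / real p)"
    \<comment> \<open>Label 0 means that \<open>f\<close> does not decrease coordinate
      \<open>i\<close>. Kuhn's lemma demands label 1 on the face \<open>y i = p\<close>; there the
      coordinate is 1, so label 1 still means that \<open>f\<close> does not increase it.\<close>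
    define label where "label = (\<lambda>y i. if y i \<noteq> p \<and> sc y i \<le> f (sc y) i then 0 else 1 :: nat)"
    have p: "0 < p" by (simp add: p_def)
    have sc_cube: "sc y \<in> cube" if "\<forall>j<N. y j \<le> p" for y
      using that p by (auto simp: sc_def cube_def divide_le_eq)
    have f01: "f (sc y) i \<in> {0..1}" if "\<forall>j<N. y j \<le> p" "i < N" for y i
      using maps[of "sc y" i] sc_cube[OF that(1)] that(2) by (auto simp: cube_def)
    obtain q where q: "\<forall>i<N. q i < p" and
      rs: "\<forall>i<N. \<exists>r s. (\<forall>j<N. q j \<le> r j \<and> r j \<le> q j + 1) \<and> (\<forall>j<N. q j \<le> s j \<and> s j \<le> q j + 1) \<and>
             label r i \<noteq> label s i"
    proof (rule kuhn_lemma[OF p, of N label])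
      show "\<forall>x. (\<forall>i<N. x i \<le> p) \<longrightarrow> (\<forall>i<N. x i = 0 \<longrightarrow> label x i = 0)"
        using f01 p by (auto simp: label_def sc_def)
    qed (auto simp: label_def)
    have near: "\<forall>j<N. \<bar>sc r j - sc q j\<bar> \<le> 1 / real (Suc k)" if "\<forall>j<N. q j \<le> r j \<and> r j \<le> q j + 1" for r
      using that unfolding sc_def p_def diff_divide_distrib[symmetric] abs_divide
      by (auto intro!: divide_right_mono simp: abs_le_iff)
    have incube: "sc r \<in> cube" if "\<forall>j<N. q j \<le> r j \<and> r j \<le> q j + 1" for r
      using that q by (intro sc_cube) (metis Suc_eq_plus1 Suc_leI le_trans)
    have "\<exists>r s. r \<in> cube \<and> s \<in> cube \<and>
      (\<forall>j<N. \<bar>r j - sc q j\<bar> \<le> 1 / real (Suc k)) \<and> (\<forall>j<N. \<bar>s j - sc q j\<bar> \<le> 1 / real (Suc k)) \<and>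
      r i \<le> f r i \<and> f s i \<le> s i" if i: "i < N" for i
    proof -
      obtain r s where r: "\<forall>j<N. q j \<le> r j \<and> r j \<le> q j + 1" and s: "\<forall>j<N. q j \<le> s j \<and> s j \<le> q j + 1"
        and l: "label r i = 0" "label s i \<noteq> 0"
        using rs i by (metis label_def zero_neq_one)
      have "f (sc s) i \<le> sc s i"
      proof (cases "s i = p")
        case True
        then show ?thesis using maps[of "sc s" i] incube[OF s] i p by (auto simp: sc_def cube_def)
      qed (use l(2) in \<open>auto simp: label_def split: if_splits\<close>)
      moreover have "sc r i \<le> f (sc r) i" using l(1) by (auto simp: label_def split: if_splits)
      ultimately show ?thesis using near[OF r] near[OF s] incube[OF r] incube[OF s] by blast
    qed
    moreover have "sc q \<in> cube" using q by (intro sc_cube) (auto intro: less_imp_le)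
    ultimately show ?thesis by blast
  qed
  define G where "G = (\<lambda>k q i r s. r \<in> cube \<and> s \<in> cube \<and>
      (\<forall>j<N. \<bar>r j - q j\<bar> \<le> 1 / real (Suc k)) \<and> (\<forall>j<N. \<bar>s j - q j\<bar> \<le> 1 / real (Suc k)) \<and>
      r i \<le> f r i \<and> f s i \<le> s i)"
  obtain q where q: "\<And>k. q k \<in> cube" and ex: "\<And>k i. i < N \<Longrightarrow> \<exists>r s. G k (q k) i r s"
  proof -
    have "\<exists>q. q \<in> cube \<and> (\<forall>i<N. \<exists>r s. G k q i r s)" for k
      using approx[of k] by (simp add: G_def Bex_def)
    then show ?thesis using that by metis
  qed
  \<comment> \<open>The witnesses depend on the coordinate \<open>i\<close> as well as on
    \<open>k\<close>. Being close to \<open>q k\<close>, they all converge to one limit along the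
    subsequence chosen below.\<close>
  define r where "r = (\<lambda>k i. SOME r. \<exists>s. G k (q k) i r s)"
  define s where "s = (\<lambda>k i. SOME s. G k (q k) i (r k i) s)"
  have ex_s: "\<exists>s. G k (q k) i (r k i) s" if "i < N" for k i
    unfolding r_def by (rule someI_ex[OF ex[OF that]])
  have "G k (q k) i (r k i) (s k i)" if "i < N" for k i
    unfolding s_def by (rule someI_ex[OF ex_s[OF that]])
  then have rs: "r k i \<in> cube \<and> s k i \<in> cube \<and>
      (\<forall>j<N. \<bar>r k i j - q k j\<bar> \<le> 1 / real (Suc k)) \<and> (\<forall>j<N. \<bar>s k i j - q k j\<bar> \<le> 1 / real (Suc k)) \<and>
      r k i i \<le> f (r k i) i \<and> f (s k i) i \<le> s k i i" if "i < N" for k i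
    using that by (simp add: G_def)
  obtain x \<phi> where \<phi>: "strict_mono (\<phi> :: nat \<Rightarrow> nat)" and lim: "\<And>j. j < N \<Longrightarrow> (\<lambda>k. q (\<phi> k) j) \<longlonglongrightarrow> x j"
  proof (rule bounded_sequence_subseq_componentwise[of N q 0 1])
    show "q k j \<in> {0..1}" if "j < N" for k j using q[of k] that by (auto simp: cube_def)
  qed blast
  have inv0: "(\<lambda>k. 1 / real (Suc (\<phi> k))) \<longlonglongrightarrow> 0"
    using LIMSEQ_subseq_LIMSEQ[OF lim_inverse_n' \<phi>] LIMSEQ_subseq_LIMSEQ[OF LIMSEQ_inverse_real_of_nat \<phi>]
    by (simp add: o_def inverse_eq_divide)
  have near_lim: "(\<lambda>k. u k j) \<longlonglongrightarrow> x j"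
    if "\<And>k. \<bar>u k j - q (\<phi> k) j\<bar> \<le> 1 / real (Suc (\<phi> k))" "j < N" for u and j
  proof -
    have "(\<lambda>k. u k j - q (\<phi> k) j) \<longlonglongrightarrow> 0"
      using that(1) by (intro Lim_null_comparison[OF _ inv0]) auto
    then show ?thesis using tendsto_add[OF _ lim[OF that(2)]] by fastforce
  qed
  have x01: "x j \<in> {0..1}" if "j < N" for j
    using closed_sequentially[OF _ _ lim[OF that], of "{0..1}"] q that by (auto simp: cube_def)
  have "f x i = x i" if i: "i < N" for i
  proof (rule antisym)
    have "(\<lambda>k. f (s (\<phi> k) i) i) \<longlonglongrightarrow> f x i"
      using rs i by (intro cont near_lim) (auto simp: cube_def)
    moreover have "(\<lambda>k. s (\<phi> k) i i) \<longlonglongrightarrow> x i"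
      using rs i by (intro near_lim[of "\<lambda>k. s (\<phi> k) i"]) auto
    ultimately show "f x i \<le> x i" by (rule LIMSEQ_le) (use rs i in auto)
    have "(\<lambda>k. r (\<phi> k) i i) \<longlonglongrightarrow> x i"
      using rs i by (intro near_lim[of "\<lambda>k. r (\<phi> k) i"]) auto
    moreover have "(\<lambda>k. f (r (\<phi> k) i) i) \<longlonglongrightarrow> f x i"
      using rs i by (intro cont near_lim) (auto simp: cube_def)
    ultimately show "x i \<le> f x i" by (rule LIMSEQ_le) (use rs i in auto)
  qed
  then show ?thesis using that x01 by blast
qed

text \<open>Transport along an enumeration of \<open>I\<close> and an affine bijection from
  \<open>[0, 1]\<close> to \<open>[-c, c]\<close>. The arbitrary index type lets matrix positions
  serve as coordinates.\<close>

lemma brouwer_box: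
  fixes f :: "('a \<Rightarrow> real) \<Rightarrow> 'a \<Rightarrow> real"
  assumes I: "finite I" and c: "c > 0"
    and maps: "\<And>x i. (\<And>j. j \<in> I \<Longrightarrow> \<bar>x j\<bar> \<le> c) \<Longrightarrow> i \<in> I \<Longrightarrow> \<bar>f x i\<bar> \<le> c"
    and cont: "\<And>X x i. (\<And>k j. j \<in> I \<Longrightarrow> \<bar>X k j\<bar> \<le> c) \<Longrightarrow>
      (\<And>j. j \<in> I \<Longrightarrow> (\<lambda>k::nat. X k j) \<longlonglongrightarrow> x j) \<Longrightarrow> i \<in> I \<Longrightarrow> (\<lambda>k. f (X k) i) \<longlonglongrightarrow> f x i"
  obtains x where "\<And>i. i \<in> I \<Longrightarrow> f x i = x i"
proof -
  obtain h where h: "bij_betw h {..<card I} I"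
    using ex_bij_betw_nat_finite[OF I] by (auto simp: atLeast0LessThan)
  define h' where "h' = the_inv_into {..<card I} h"
  have h': "h' i < card I" "h (h' i) = i" if "i \<in> I" for i
    using h that unfolding h'_def bij_betw_def
    by (metis lessThan_iff the_inv_into_into subset_refl, metis f_the_inv_into_f)
  have hI: "h k \<in> I" "h' (h k) = k" if "k < card I" for k
    using h that unfolding h'_def bij_betw_def by (auto simp: the_inv_into_f_f)
  define T where "T = (\<lambda>(y :: nat \<Rightarrow> real) i. c * (2 * y (h' i) - 1))"
  have T: "\<bar>T y i\<bar> \<le> c" if "\<And>j. j < card I \<Longrightarrow> y j \<in> {0..1}" "i \<in> I" for y i
  proof -
    have "\<bar>2 * y (h' i) - 1\<bar> \<le> 1" using that(1)[OF h'(1)[OF that(2)]] by auto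
    then show ?thesis using c by (simp add: T_def abs_mult)
  qed
  define F where "F = (\<lambda>y k. (f (T y) (h k) / c + 1) / 2)"
  obtain y where y: "\<And>k. k < card I \<Longrightarrow> F y k = y k"
  proof (rule brouwer_unit_cube[of "card I" F])
    fix x :: "nat \<Rightarrow> real" and i assume x: "\<And>j. j < card I \<Longrightarrow> x j \<in> {0..1}" and i: "i < card I"
    have "\<bar>f (T x) (h i)\<bar> \<le> c" using T[OF x] hI(1)[OF i] by (intro maps) auto
    then have "- 1 \<le> f (T x) (h i) / c \<and> f (T x) (h i) / c \<le> 1"
      using c by (auto simp: field_simps abs_le_iff)
    then show "F x i \<in> {0..1}" by (auto simp: F_def)
  next
    fix X :: "nat \<Rightarrow> nat \<Rightarrow> real" and x i assume X: "\<And>k j. j < card I \<Longrightarrow> X k j \<in> {0..1}"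
      and lim: "\<And>j. j < card I \<Longrightarrow> (\<lambda>k::nat. X k j) \<longlonglongrightarrow> x j" and i: "i < card I"
    have "(\<lambda>k. f (T (X k)) (h i)) \<longlonglongrightarrow> f (T x) (h i)"
      using X hI[OF i] h' by (intro cont T) (auto simp: T_def intro!: tendsto_intros lim)
    then show "(\<lambda>k. F (X k) i) \<longlonglongrightarrow> F x i"
      unfolding F_def using c by (intro tendsto_intros) auto
  qed auto
  have "f (T y) i = T y i" if "i \<in> I" for i
    using y[OF h'(1)[OF that]] h'(2)[OF that] c by (simp add: F_def T_def field_simps)
  then show ?thesis by (rule that)
qed

section \<open>Truncated powers and fixed points among Hermitian matrices\<close>

text \<open>The constant is the absolute derivative of \<open>x^(-a)\<close> at \<open>m\<close>,
  its largest value to the right of \<open>m\<close>. Truncation by \<open>max\<close> is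
  1-Lipschitz and moves both arguments into that range, where the mean value theorem
  applies.\<close>

lemma powr_trunc_lipschitz:
  fixes m a x y :: real
  assumes m: "m > 0" and a: "a \<ge> 0"
  shows "\<bar>max x m powr (- a) - max y m powr (- a)\<bar> \<le> a * m powr (- a - 1) * \<bar>x - y\<bar>"
proof -
  have *: "\<bar>v powr (- a) - u powr (- a)\<bar> \<le> a * m powr (- a - 1) * \<bar>v - u\<bar>" if uv: "m \<le> u" "u < v" for u v
  proof -
    have "\<exists>z>u. z < v \<and> v powr (- a) - u powr (- a) = (v - u) * (- a * z powr (- a - 1))"
      using uv m has_real_derivative_powr[of _ "- a"] by (intro MVT2) (auto simp del: mult_minus_left)
    then obtain z where z: "z > u" and eq: "v powr (- a) - u powr (- a) = (v - u) * (- a * z powr (- a - 1))"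
      by blast
    have "z powr (- a - 1) \<le> m powr (- a - 1)" using z uv m a by (intro powr_mono2') auto
    then have "a * z powr (- a - 1) * (v - u) \<le> a * m powr (- a - 1) * (v - u)"
      using a uv by (intro mult_right_mono mult_left_mono) auto
    then show ?thesis unfolding eq using uv a by (simp add: abs_mult mult_ac)
  qed
  have "\<bar>max x m powr (- a) - max y m powr (- a)\<bar> \<le> a * m powr (- a - 1) * \<bar>max x m - max y m\<bar>"
    using *[of "max x m" "max y m"] *[of "max y m" "max x m"]
    by (cases "max x m" "max y m" rule: linorder_cases) (auto simp: abs_minus_commute)
  also have "\<dots> \<le> a * m powr (- a - 1) * \<bar>x - y\<bar>"
    using a by (intro mult_left_mono) auto
  finally show ?thesis .
qed

text \<open>Entrywise convergence is passed to the Frobenius norm, where the Lipschitz estimate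
  holds, and back to entries.\<close>

lemma fcalc_tendsto:
  assumes Z: "\<And>k. Z k \<in> carrier_mat n n" "\<And>k. hermitian (Z k)"
    and Y: "Y \<in> carrier_mat n n" "hermitian Y"
    and lim: "\<And>i j. i < n \<Longrightarrow> j < n \<Longrightarrow> (\<lambda>k::nat. Z k $$ (i, j)) \<longlonglongrightarrow> Y $$ (i, j)"
    and g: "\<And>x y. \<bar>g x - g y\<bar> \<le> L * \<bar>x - y\<bar>" and ij: "i < n" "j < n"
  shows "(\<lambda>k. fcalc g (Z k) $$ (i, j)) \<longlonglongrightarrow> fcalc g Y $$ (i, j)"
proof -
  have carr: "fcalc g M \<in> carrier_mat n n" if "M \<in> carrier_mat n n" "hermitian M" for M
    using hermitian_diagonalizes[OF that] diagonalizesD(4)[OF diagonalizes_fcalc] by metis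
  have "(\<lambda>k. \<Sum>j<n. \<Sum>i<n. (cmod (Z k $$ (i, j) - Y $$ (i, j)))\<^sup>2) \<longlonglongrightarrow>
      (\<Sum>j<n. \<Sum>i<n. (cmod (Y $$ (i, j) - Y $$ (i, j)))\<^sup>2)"
    by (intro tendsto_intros lim) auto
  moreover have "frob_sq (Z k - Y) = (\<Sum>j<n. \<Sum>i<n. (cmod (Z k $$ (i, j) - Y $$ (i, j)))\<^sup>2)" for k
    using Z(1)[of k] Y(1) by (simp add: frob_sq_def)
  ultimately have "(\<lambda>k. frob_sq (Z k - Y)) \<longlonglongrightarrow> 0" by simp
  then have lim0: "(\<lambda>k. L\<^sup>2 * frob_sq (Z k - Y)) \<longlonglongrightarrow> 0"
    using tendsto_mult_right_zero by blast
  have "(cmod (fcalc g (Z k) $$ (i, j) - fcalc g Y $$ (i, j)))\<^sup>2 \<le> L\<^sup>2 * frob_sq (Z k - Y)" for k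
    using cmod_index_le_frob_sq[of i "fcalc g (Z k) - fcalc g Y" j] ij carr[OF Z(1,2), of k] carr[OF Y]
      frob_sq_fcalc_lipschitz[OF Z(1,2) Y g, of k] by simp
  then have "(\<lambda>k. (cmod (fcalc g (Z k) $$ (i, j) - fcalc g Y $$ (i, j)))\<^sup>2) \<longlonglongrightarrow> 0"
    by (intro Lim_null_comparison[OF _ lim0]) auto
  then have "(\<lambda>k. cmod (fcalc g (Z k) $$ (i, j) - fcalc g Y $$ (i, j))) \<longlonglongrightarrow> 0"
    using tendsto_real_sqrt by fastforce
  then show ?thesis
    by (rule LIM_zero_cancel[OF tendsto_norm_zero_cancel])
qed

lemma mult_mat_tendsto:
  fixes M :: "nat \<Rightarrow> complex mat"
  assumes "\<And>k. M k \<in> carrier_mat n n" "N \<in> carrier_mat n n" "C \<in> carrier_mat n n" "D \<in> carrier_mat n n"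
    and "\<And>i j. i < n \<Longrightarrow> j < n \<Longrightarrow> (\<lambda>k. M k $$ (i, j)) \<longlonglongrightarrow> N $$ (i, j)" and ij: "i < n" "j < n"
  shows "(\<lambda>k. (C * M k * D) $$ (i, j)) \<longlonglongrightarrow> (C * N * D) $$ (i, j)"
proof -
  have eq: "(C * M * D) $$ (i, j) = (\<Sum>h<n. C $$ (i, h) * (\<Sum>l<n. M $$ (h, l) * D $$ (l, j)))"
    if "M \<in> carrier_mat n n" for M
    using assms(3,4) that ij by (auto simp: scalar_prod_def atLeast0LessThan intro!: sum.cong)
  show ?thesis
    unfolding eq[OF assms(1)] eq[OF assms(2)] by (intro tendsto_intros assms(5)) auto
qed

lemma frob_sq_diagonalizes:
  assumes "diagonalizes n U d M"
  shows "frob_sq M = (\<Sum>i<n. (d i)\<^sup>2)"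
proof -
  note D = diagonalizesD[OF assms]
  have "frob_sq M = frob_sq (real_diag n d)"
    using D(1,2) by (simp add: D(3) frob_sq_unitary_right[of _ n] frob_sq_unitary_left[of _ n] unitary_adjoint)
  also have "\<dots> = (\<Sum>i<n. (d i)\<^sup>2)"
    by (auto simp: frob_sq_def real_diag_def if_distrib[of cmod] if_distrib[of "\<lambda>x. x\<^sup>2"]
        intro!: sum.cong cong: if_cong)
  finally show ?thesis .
qed

text \<open>All real and imaginary parts of the entries serve as coordinates, and \<open>mk\<close>
  takes the Hermitian part. At a fixed point the coordinates are those of \<open>F (mk x)\<close>,
  which is Hermitian already, so taking the Hermitian part changes nothing and \<open>mk x\<close>
  is fixed by \<open>F\<close>.\<close>

lemma hermitian_brouwer:
  fixes F :: "complex mat \<Rightarrow> complex mat"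
  assumes F: "\<And>Y. Y \<in> carrier_mat n n \<Longrightarrow> hermitian Y \<Longrightarrow> F Y \<in> carrier_mat n n"
      "\<And>Y. Y \<in> carrier_mat n n \<Longrightarrow> hermitian Y \<Longrightarrow> hermitian (F Y)"
    and bounded: "\<And>Y i j. Y \<in> carrier_mat n n \<Longrightarrow> hermitian Y \<Longrightarrow> i < n \<Longrightarrow> j < n \<Longrightarrow> cmod (F Y $$ (i, j)) \<le> c"
    and cont: "\<And>Z Y i j. (\<And>k. Z k \<in> carrier_mat n n) \<Longrightarrow> (\<And>k. hermitian (Z k)) \<Longrightarrow>
      Y \<in> carrier_mat n n \<Longrightarrow> hermitian Y \<Longrightarrow>
      (\<And>i j. i < n \<Longrightarrow> j < n \<Longrightarrow> (\<lambda>k::nat. Z k $$ (i, j)) \<longlonglongrightarrow> Y $$ (i, j)) \<Longrightarrow>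
      i < n \<Longrightarrow> j < n \<Longrightarrow> (\<lambda>k. F (Z k) $$ (i, j)) \<longlonglongrightarrow> F Y $$ (i, j)"
  obtains Y where "Y \<in> carrier_mat n n" "hermitian Y" "F Y = Y"
proof -
  define E where "E = (\<lambda>(x :: nat \<times> nat \<times> bool \<Rightarrow> real) i j. Complex (x (i, j, True)) (x (i, j, False)))"
  define mk where "mk = (\<lambda>x. mat n n (\<lambda>(i, j). (E x i j + cnj (E x j i)) / 2))"
  define f where "f = (\<lambda>x (i, j, b). if b then Re (F (mk x) $$ (i, j)) else Im (F (mk x) $$ (i, j)))"
  have mk: "mk x \<in> carrier_mat n n" "hermitian (mk x)" for x
    by (auto simp: mk_def hermitian_def intro!: eq_matI)
  define I where "I = {..<n} \<times> {..<n} \<times> (UNIV :: bool set)"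
  obtain x where x: "\<And>i. i \<in> I \<Longrightarrow> f x i = x i"
  \<comment> \<open>The box needs a positive half-width, and nothing is assumed about the sign of
    \<open>c\<close>.\<close>
  proof (rule brouwer_box[of I "max c 1" f])
    fix x i assume "i \<in> I"
    then obtain a b t where i: "i = (a, b, t)" "a < n" "b < n" by (auto simp: I_def)
    have "\<bar>f x i\<bar> \<le> cmod (F (mk x) $$ (a, b))"
      by (simp add: f_def i abs_Re_le_cmod abs_Im_le_cmod)
    also have "\<dots> \<le> c" using bounded[OF mk i(2,3)] .
    finally show "\<bar>f x i\<bar> \<le> max c 1" by simp
  next
    fix X :: "nat \<Rightarrow> nat \<times> nat \<times> bool \<Rightarrow> real" and x i
    assume lim: "\<And>j. j \<in> I \<Longrightarrow> (\<lambda>k. X k j) \<longlonglongrightarrow> x j" and "i \<in> I"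
    then obtain a b t where i: "i = (a, b, t)" "a < n" "b < n" by (auto simp: I_def)
    have E: "(\<lambda>k. E (X k) i j) \<longlonglongrightarrow> E x i j" if "i < n" "j < n" for i j
      unfolding E_def using that by (intro tendsto_Complex lim) (auto simp: I_def)
    have "(\<lambda>k. mk (X k) $$ (i, j)) \<longlonglongrightarrow> mk x $$ (i, j)" if "i < n" "j < n" for i j
      using that by (auto simp: mk_def intro!: tendsto_intros E)
    then have "(\<lambda>k. F (mk (X k)) $$ (a, b)) \<longlonglongrightarrow> F (mk x) $$ (a, b)"
      using i by (intro cont mk)
    then show "(\<lambda>k. f (X k) i) \<longlonglongrightarrow> f x i"
      by (cases t) (auto simp: f_def i intro!: tendsto_intros)
  qed (auto simp: I_def)
  have Ex: "E x i j = F (mk x) $$ (i, j)" if "i < n" "j < n" for i j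
    using x[of "(i, j, True)"] x[of "(i, j, False)"] that by (auto simp: I_def f_def E_def complex_eq_iff)
  have Fm: "F (mk x) \<in> carrier_mat n n" "mat_adjoint (F (mk x)) = F (mk x)"
    using F[OF mk] by (auto simp: hermitianD)
  have sym: "cnj (F (mk x) $$ (j, i)) = F (mk x) $$ (i, j)" if "i < n" "j < n" for i j
    using arg_cong[OF Fm(2), of "\<lambda>M. M $$ (i, j)"] Fm(1) that by simp
  have "F (mk x) = mk x"
  proof (rule eq_matI)
    fix i j assume "i < dim_row (mk x)" "j < dim_col (mk x)"
    then have ij: "i < n" "j < n" by (auto simp: mk_def)
    have "mk x $$ (i, j) = (E x i j + cnj (E x j i)) / 2" using ij by (simp add: mk_def)
    also have "\<dots> = F (mk x) $$ (i, j)" using ij by (simp add: Ex sym)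
    finally show "F (mk x) $$ (i, j) = mk x $$ (i, j)" ..
  qed (use Fm(1) mk(1)[of x] in auto)
  then show ?thesis using that mk by blast
qed

lemma mat_powr_powr:
  assumes "M \<in> PD n"
  shows "mat_powr (mat_powr M r) s = mat_powr M (r * s)"
proof -
  obtain U d where D: "diagonalizes n U d M" "\<And>i. i < n \<Longrightarrow> d i > 0"
    using PD_diagonalizes[OF assms] by blast
  have D': "diagonalizes n U (\<lambda>i. d i powr r) (mat_powr M r)" "\<And>i. i < n \<Longrightarrow> d i powr r > 0"
    using diagonalizes_mat_powr[OF D] D(2) by force+
  show ?thesis
    by (rule diagonalizes_cong[OF diagonalizes_mat_powr[OF D'] diagonalizes_mat_powr[OF D]])
      (simp_all add: powr_powr)
qed

lemma qform_smult_one: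
  assumes "v \<in> carrier_vec n"
  shows "qform (complex_of_real c \<cdot>\<^sub>m 1\<^sub>m n) v = c * (vnorm v)\<^sup>2"
proof -
  have "diagonalizes n (1\<^sub>m n) (\<lambda>_. c) (complex_of_real c \<cdot>\<^sub>m 1\<^sub>m n)"
  proof -
    have "real_diag n (\<lambda>_. c) = complex_of_real c \<cdot>\<^sub>m 1\<^sub>m n"
      by (intro eq_matI) (auto simp: real_diag_def)
    then show ?thesis
      by (auto simp: diagonalizes_def unitary_def left_mult_one_mat[of _ n n] right_mult_one_mat[of _ n n])
  qed
  then show ?thesis
    using qform_le_if_eigenvalues_le[of n _ _ _ v c] qform_ge_if_eigenvalues_ge[of n _ _ _ v c] assms
    by (metis order_antisym order_refl)
qed

section \<open>The matrix equation\<close>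

theorem mainTheorem4:
  fixes n :: nat and s t p :: real and A B Q :: "complex mat"
  assumes n_pos: "0 < n"
    and s: "s \<ge> 1" and t: "t \<ge> 1" and p: "p \<ge> 1"
    and A: "A \<in> GL n" and B: "B \<in> GL n"
    and Q: "Q \<in> PD n" and Q1: "lambda_max Q \<le> 1"
    and cond: "let k = lambda_min Q; q = min (t / s) (p / s); q' = max (t / s) (p / s)
               in (op_norm A)\<^sup>2 + (op_norm B)\<^sup>2 < q powr q' * k powr (q' + 1) / (q + 1) powr (q' + 1)"
  shows "let k = lambda_min Q; q = min (t / s) (p / s)
         in \<exists>X \<in> PD n.
              mat_powr X s + mat_adjoint A * mat_powr X (- t) * A
                + mat_adjoint B * mat_powr X (- p) * B = Q
            \<and> X \<in> mat_interval (complex_of_real ((q * k / (q + 1)) powr (1 / s)) \<cdot>\<^sub>m 1\<^sub>m n)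
                                (mat_powr Q (1 / s))"
proof -
  define k where "k = lambda_min Q"
  define a where "a = t / s"
  define b where "b = p / s"
  define q where "q = min a b"
  define q' where "q' = max a b"
  define m where "m = q * k / (q + 1)"
  define g where "g = (\<lambda>c x. max x m powr (- c))"
  have ab: "a > 0" "b > 0" using s t p by (auto simp: a_def b_def)
  have q: "q > 0" using ab by (simp add: q_def)
  have Ac: "A \<in> carrier_mat n n" and Bc: "B \<in> carrier_mat n n" using A B by (auto simp: GL_def)
  have Qc: "Q \<in> carrier_mat n n" and Qh: "hermitian Q" using PD_carrier[OF Q] PD_hermitian[OF Q] .
  obtain U d where D: "diagonalizes n U d Q" "\<And>i. i < n \<Longrightarrow> d i > 0" using PD_diagonalizes[OF Q] by blast
  have kpos: "k > 0" using lambda_min_pos[OF Q n_pos] by (simp add: k_def)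
  have dk: "k \<le> d i" "d i \<le> 1" if "i < n" for i
    using lambda_bounds[OF D(1) that] Q1 by (auto simp: k_def)
  have k1: "k \<le> 1" using dk[OF n_pos] by linarith
  have m: "m > 0" using q kpos by (simp add: m_def)
  have m1: "m \<le> 1"
  proof -
    have "q * k \<le> q * 1" using q k1 by (intro mult_left_mono) auto
    then have "q * k \<le> q + 1" by linarith
    then show ?thesis using q by (simp add: m_def)
  qed
  \<comment> \<open>The norm condition multiplied by \<open>m powr (- q')\<close>: the powers with
    exponent \<open>q'\<close> cancel and leave \<open>k / (q + 1)\<close>.\<close>
  have key: "((op_norm A)\<^sup>2 + (op_norm B)\<^sup>2) * m powr (- q') \<le> k - m"
  proof -
    have "((op_norm A)\<^sup>2 + (op_norm B)\<^sup>2) * m powr (- q') \<le>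
        q powr q' * k powr (q' + 1) / (q + 1) powr (q' + 1) * m powr (- q')"
      using cond by (intro mult_right_mono) (auto simp: Let_def k_def q_def q'_def a_def b_def)
    also have "\<dots> = k / (q + 1)"
    proof -
      define x where "x = q powr q'"
      define y where "y = k powr q'"
      define z where "z = (q + 1) powr q'"
      have "x > 0" "y > 0" "z > 0" using q kpos by (auto simp: x_def y_def z_def)
      moreover have "m powr (- q') = z / (x * y)"
        using q kpos by (simp add: m_def powr_minus powr_divide powr_mult x_def y_def z_def)
      moreover have "k powr (q' + 1) = y * k" "(q + 1) powr (q' + 1) = z * (q + 1)"
        using q kpos by (simp_all add: powr_add y_def z_def)
      ultimately show ?thesis
        unfolding x_def[symmetric] by simp
    qed
    also have "\<dots> = k - m" using q by (simp add: m_def field_simps)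
    finally show ?thesis .
  qed
  have g_nonneg: "0 \<le> g c x" for c x by (simp add: g_def)
  \<comment> \<open>Truncation reduces to the value at \<open>m\<close>; as \<open>m\<close> \<le>
    1, the largest exponent then gives the largest negative power.\<close>
  have g_le: "g c x \<le> m powr (- q')" if "c \<in> {a, b}" for c x
  proof -
    have "max x m powr (- c) \<le> m powr (- c)" using m ab that by (intro powr_mono2') auto
    also have "\<dots> \<le> m powr (- q')" using m m1 that by (intro powr_mono') (auto simp: q'_def)
    finally show ?thesis by (simp add: g_def)
  qed
  define F where "F = (\<lambda>Y. Q - mat_adjoint A * fcalc (g a) Y * A - mat_adjoint B * fcalc (g b) Y * B)"
  have fc: "fcalc h Y \<in> carrier_mat n n" "hermitian (fcalc h Y)"
    if "Y \<in> carrier_mat n n" "hermitian Y" for h Y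
    using hermitian_diagonalizes[OF that] diagonalizesD(4)[OF diagonalizes_fcalc]
      diagonalizes_hermitian[OF diagonalizes_fcalc] by metis+
  have FY: "F Y \<in> carrier_mat n n" "hermitian (F Y)" if Y: "Y \<in> carrier_mat n n" "hermitian Y" for Y
  proof -
    show "F Y \<in> carrier_mat n n" using Ac Bc Qc fc[OF Y] by (simp add: F_def)
    have "hermitian (mat_adjoint A * fcalc (g a) Y * A)" "hermitian (mat_adjoint B * fcalc (g b) Y * B)"
      using Ac Bc fc[OF Y] by (auto intro: hermitian_adjoint_mult)
    then show "hermitian (F Y)"
      using Ac Bc Qc Qh fc[OF Y] by (simp add: F_def hermitian_def mat_adjoint_minus[of _ n n])
  qed
  have term_bounds: "0 \<le> qform (mat_adjoint C * fcalc (g c) Y * C) v"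
      "qform (mat_adjoint C * fcalc (g c) Y * C) v \<le> (op_norm C)\<^sup>2 * m powr (- q') * (vnorm v)\<^sup>2"
    if Y: "Y \<in> carrier_mat n n" "hermitian Y" and C: "C \<in> carrier_mat n n" and c: "c \<in> {a, b}"
      and v: "v \<in> carrier_vec n" for Y C c v
  proof -
    obtain V e where V: "diagonalizes n V e Y" using hermitian_diagonalizes[OF Y] .
    note G = diagonalizes_fcalc[OF V, of "g c"]
    have Cv: "C *\<^sub>v v \<in> carrier_vec n" using C v by simp
    have eq: "qform (mat_adjoint C * fcalc (g c) Y * C) v = qform (fcalc (g c) Y) (C *\<^sub>v v)"
      using fc[OF Y] C v by (intro qform_adjoint_mult) auto
    show "0 \<le> qform (mat_adjoint C * fcalc (g c) Y * C) v"
      using qform_ge_if_eigenvalues_ge[OF G Cv, of 0] g_nonneg by (simp add: eq)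
    have "qform (fcalc (g c) Y) (C *\<^sub>v v) \<le> m powr (- q') * (vnorm (C *\<^sub>v v))\<^sup>2"
      using qform_le_if_eigenvalues_le[OF G Cv] g_le[OF c] by blast
    also have "\<dots> \<le> m powr (- q') * (op_norm C * vnorm v)\<^sup>2"
      by (intro mult_left_mono power_mono vnorm_mult_le_op_norm[OF C v]) auto
    finally show "qform (mat_adjoint C * fcalc (g c) Y * C) v \<le> (op_norm C)\<^sup>2 * m powr (- q') * (vnorm v)\<^sup>2"
      by (simp add: eq power_mult_distrib mult_ac)
  qed
  have F_ge: "m * (vnorm v)\<^sup>2 \<le> qform (F Y) v" and F_le: "qform (F Y) v \<le> qform Q v"
    if Y: "Y \<in> carrier_mat n n" "hermitian Y" and v: "v \<in> carrier_vec n" for Y v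
  proof -
    have eq: "qform (F Y) v = qform Q v - qform (mat_adjoint A * fcalc (g a) Y * A) v
        - qform (mat_adjoint B * fcalc (g b) Y * B) v"
      using Ac Bc Qc fc[OF Y] v by (simp add: F_def qform_minus[of _ n])
    note TA = term_bounds[OF Y Ac _ v, of a] and TB = term_bounds[OF Y Bc _ v, of b]
    show "qform (F Y) v \<le> qform Q v" using TA TB by (simp add: eq)
    \<comment> \<open>The form of \<open>Q\<close> is at least \<open>k\<close> times the squared
      length, and the two subtracted terms together use up at most \<open>k - m\<close> of
      it.\<close>
    have "((op_norm A)\<^sup>2 + (op_norm B)\<^sup>2) * m powr (- q') * (vnorm v)\<^sup>2 \<le> (k - m) * (vnorm v)\<^sup>2"
      using key by (intro mult_right_mono) auto
    moreover have "k * (vnorm v)\<^sup>2 \<le> qform Q v"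
      using qform_ge_if_eigenvalues_ge[OF D(1) v] dk by blast
    ultimately show "m * (vnorm v)\<^sup>2 \<le> qform (F Y) v"
      using TA TB by (simp add: eq algebra_simps)
  qed
  obtain Y where Y: "Y \<in> carrier_mat n n" "hermitian Y" and fix_Y: "F Y = Y"
  \<comment> \<open>The eigenvalues of \<open>F Y\<close> lie in \<open>[m, 1]\<close>, so its
    squared Frobenius norm is at most \<open>n\<close>, and this dominates each squared
    entry.\<close>
  proof (rule hermitian_brouwer[of n F "sqrt n"])
    fix Y i j assume Y: "Y \<in> carrier_mat n n" "hermitian Y" and ij: "i < n" "j < n"
    obtain V e where V: "diagonalizes n V e (F Y)" using hermitian_diagonalizes[OF FY[OF Y]] .
    have "(e l)\<^sup>2 \<le> 1" if l: "l < n" for l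
    proof -
      note c = diagonalizes_mult_col[OF V l]
      have "m \<le> e l" using F_ge[OF Y c(1)] c by simp
      moreover have "e l \<le> qform Q (col V l)" using F_le[OF Y c(1)] c by simp
      moreover have "qform Q (col V l) \<le> 1"
        using qform_le_if_eigenvalues_le[OF D(1) c(1) dk(2)] c(2) by simp
      ultimately have "0 \<le> e l" "e l \<le> 1" using m by linarith+
      then show ?thesis by (simp add: power_le_one)
    qed
    then have "frob_sq (F Y) \<le> real n"
      using sum_mono[of "{..<n}" "\<lambda>i. (e i)\<^sup>2" "\<lambda>_. 1"] by (simp add: frob_sq_diagonalizes[OF V])
    then have "(cmod (F Y $$ (i, j)))\<^sup>2 \<le> real n"
      using cmod_index_le_frob_sq[of i "F Y" j] FY(1)[OF Y] ij by simp
    then show "cmod (F Y $$ (i, j)) \<le> sqrt (real n)" by (rule real_le_rsqrt)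
  next
    fix Z Y i j
    assume Z: "\<And>l. Z l \<in> carrier_mat n n" "\<And>l. hermitian (Z l)" and Y: "Y \<in> carrier_mat n n" "hermitian Y"
      and lim: "\<And>i j. i < n \<Longrightarrow> j < n \<Longrightarrow> (\<lambda>l::nat. Z l $$ (i, j)) \<longlonglongrightarrow> Y $$ (i, j)" and ij: "i < n" "j < n"
    have lip: "\<bar>g c x - g c y\<bar> \<le> c * m powr (- c - 1) * \<bar>x - y\<bar>" if "c > 0" for c x y
      unfolding g_def using m that by (intro powr_trunc_lipschitz) auto
    have "(\<lambda>l. (mat_adjoint C * fcalc (g c) (Z l) * C) $$ (i, j)) \<longlonglongrightarrow> (mat_adjoint C * fcalc (g c) Y * C) $$ (i, j)"
      if "C \<in> carrier_mat n n" "c > 0" for C c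
      using that ij fc[OF Z] fc[OF Y] by (intro mult_mat_tendsto fcalc_tendsto[OF Z Y lim lip]) auto
    note T = this[OF Ac ab(1)] this[OF Bc ab(2)]
    have "F Y $$ (i, j) = Q $$ (i, j) - (mat_adjoint A * fcalc (g a) Y * A) $$ (i, j)
        - (mat_adjoint B * fcalc (g b) Y * B) $$ (i, j)" if "Y \<in> carrier_mat n n" "hermitian Y" for Y
      using that ij fc[OF that] Ac Bc Qc by (simp add: F_def del: index_mult_mat(1))
    then show "(\<lambda>l. F (Z l) $$ (i, j)) \<longlonglongrightarrow> F Y $$ (i, j)"
      using Z Y T by (simp del: index_mult_mat(1)) (intro tendsto_intros)
  qed (use FY in auto)
  obtain V e where V: "diagonalizes n V e Y" using hermitian_diagonalizes[OF Y] .
  \<comment> \<open>\<open>F_ge\<close> is tested on the eigenvectors of the fixed point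
    itself.\<close>
  have em: "m \<le> e i" if "i < n" for i
    using F_ge[OF Y diagonalizes_mult_col(1)[OF V that]] diagonalizes_mult_col[OF V that] by (simp add: fix_Y)
  have e_pos: "0 < e i" if "i < n" for i using em[OF that] m by linarith
  have YPD: "Y \<in> PD n" using PD_I[OF V e_pos] .
  have fcalc_Y: "fcalc (g c) Y = mat_powr Y (- c)" for c
    by (rule fcalc_eqI[OF V diagonalizes_mat_powr[OF V e_pos]]) (simp_all add: g_def em max_absorb1)
  define X where "X = mat_powr Y (1 / s)"
  have X: "X \<in> PD n" using YPD by (simp add: X_def)
  have Xpow: "mat_powr X s = Y" "mat_powr X (- t) = fcalc (g a) Y" "mat_powr X (- p) = fcalc (g b) Y"
    using YPD s by (simp_all add: X_def mat_powr_powr mat_powr_one fcalc_Y a_def b_def)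
  have "Y + mat_adjoint A * fcalc (g a) Y * A + mat_adjoint B * fcalc (g b) Y * B = Q"
  proof -
    define TA where "TA = mat_adjoint A * fcalc (g a) Y * A"
    define TB where "TB = mat_adjoint B * fcalc (g b) Y * B"
    have T: "TA \<in> carrier_mat n n" "TB \<in> carrier_mat n n" using Ac Bc fc[OF Y] by (auto simp: TA_def TB_def)
    have "Y = Q - TA - TB" using fix_Y by (simp add: F_def TA_def TB_def)
    then have "Y + TA + TB = Q - TA - TB + TA + TB" by simp
    also have "\<dots> = Q" using T Qc by (intro eq_matI) auto
    finally show ?thesis by (simp add: TA_def TB_def)
  qed
  then have eqn: "mat_powr X s + mat_adjoint A * mat_powr X (- t) * A + mat_adjoint B * mat_powr X (- p) * B = Q"
    by (simp add: Xpow)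
  have low: "loewner_le (complex_of_real (m powr (1 / s)) \<cdot>\<^sub>m 1\<^sub>m n) X"
  proof -
    \<comment> \<open>Comparison with a multiple of the identity is a statement about eigenvalues,
      so monotonicity of the scalar power suffices.\<close>
    have "m powr (1 / s) * (vnorm v)\<^sup>2 \<le> qform X v" if "v \<in> carrier_vec n" for v
      unfolding X_def using em m s that
      by (intro qform_ge_if_eigenvalues_ge[OF diagonalizes_mat_powr[OF V e_pos]] powr_mono2) auto
    moreover have "hermitian (complex_of_real (m powr (1 / s)) \<cdot>\<^sub>m 1\<^sub>m n)"
      by (auto simp: hermitian_def intro!: eq_matI)
    ultimately show ?thesis
      using X by (subst loewner_le_iff[of _ n]) (auto simp: qform_smult_one PD_hermitian)
  qed
  have up: "loewner_le X (mat_powr Q (1 / s))"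
  proof -
    have "qform Y v \<le> qform Q v" if "v \<in> carrier_vec n" for v
      using F_le[OF Y that] by (simp add: fix_Y)
    \<comment> \<open>From \<open>s\<close> \<ge> 1 the exponent \<open>1 / s\<close> lies in
      \<open>[0, 1]\<close>, the range of Loewner-Heinz.\<close>
    then have "qform X v \<le> qform (mat_powr Q (1 / s)) v" if "v \<in> carrier_vec n" for v
      unfolding X_def using s that by (intro qform_mat_powr_mono[OF YPD Q]) auto
    then show ?thesis
      using X Q PD_hermitian[OF X] PD_hermitian[OF mat_powr_PD[OF Q]]
      by (subst loewner_le_iff[of _ n]) auto
  qed
  have "X \<in> mat_interval (complex_of_real (m powr (1 / s)) \<cdot>\<^sub>m 1\<^sub>m n) (mat_powr Q (1 / s))"
    using low up PD_hermitian[OF X] by (simp add: mat_interval_def)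
  then show ?thesis
    using X eqn unfolding Let_def k_def[symmetric] a_def[symmetric] b_def[symmetric] q_def[symmetric] m_def[symmetric]
    by blast
qed

end
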